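(* Let $0<\beta\le 1$, $1<\alpha\le 2$ and let $d\ge 1$ be an integer with $d\alpha>2$. Let $B_{\beta,\alpha}=\{B_{\beta,\alpha}(t),\,t\ge 0\}$ be a generalized grey Brownian motion in $\mathbb{R}^d$ defined on a complete probability space $(\Omega,\mathcal{F},\mathbb{P})$. Let $x\in\mathbb{R}^d$ and let $f\in CL(\mathbb{R}^d)$, i.e. $f:\mathbb{R}^d\to\mathbb{R}$ is continuous, bounded and belongs to $L^1(\mathbb{R}^d)$. Then the perpetual integral functional $\int_0^\infty f(x+B_{\beta,\alpha}(t))\,\mathrm{d}t$ is finite $\mathbb{P}$-almost surely, and its expectation equals $$\mathbb{E}\left[\int_0^\infty f(x+B_{\beta,\alpha}(t))\,\mathrm{d}t\right]=D\int_{\mathbb{R}^d}\frac{f(x+y)}{|y|^{d-2/\alpha}}\,\mathrm{d}y,$$ where $$D=D(\beta,\alpha,d)=\frac{1}{\alpha}\,2^{-1/\alpha}\,\pi^{-d/2}\,\Gamma\left(\frac d2-\frac1\alpha\right)\frac{\Gamma\left(1-\frac1\alpha\right)}{\Gamma\left(1-\frac\beta\alpha\right)}.$$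
   Context: $\Gamma$ is the Euler gamma function, $|\cdot|$ is the Euclidean norm, and $\mathbb{E}$ is expectation with respect to $\mathbb{P}$. For $0<\beta\le 1$ the Mittag-Leffler function is $E_\beta(z)=\sum_{n=0}^\infty \frac{z^n}{\Gamma(\beta n+1)}$, $z\in\mathbb{C}$. The $M$-Wright function is $M_\beta(z)=\sum_{n=0}^\infty\frac{(-z)^n}{n!\,\Gamma(-\beta n+1-\beta)}$ for $0<\beta<1$; it is a probability density on $[0,\infty)$ with Laplace transform $\int_0^\infty e^{-s\tau}M_\beta(\tau)\,\mathrm{d}\tau=E_\beta(-s)$, $s\ge 0$. For $\beta=1$, $M_1(\tau)\,\mathrm{d}\tau$ is understood as the Dirac measure at $\tau=1$. Definition (generalized grey Brownian motion, ggBm). Let $0<\beta\le1$ and $0<\alpha\le 2$. A $d$-dimensional continuous stochastic process $B_{\beta,\alpha}=\{B_{\beta,\alpha}(t),\,t\ge0\}$ on a complete probability space $(\Omega,\mathcal{F},\mathbb{P})$ is a ggBm in $\mathbb{R}^d$ if: (1) $\mathbb{P}(B_{\beta,\alpha}(0)=0)=1$; (2) for all $0\le t_1<t_2<\dots<t_n<\infty$ and all $\theta=(\theta_1,\dots,\theta_n)\in(\mathbb{R}^d)^n$ with $\theta_k=(\theta_{k,1},\dots,\theta_{k,d})$, $$\mathbb{E}\left[\exp\left(\mathrm{i}\sum_{k=1}^n(\theta_k,B_{\beta,\alpha}(t_k))_{\mathbb{R}^d}\right)\right]=E_\beta\left(-\frac12\sum_{j=1}^d(\theta_{\cdot,j},\gamma_\alpha\theta_{\cdot,j})_{\mathbb{R}^n}\right),$$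 where $\theta_{\cdot,j}=(\theta_{1,j},\dots,\theta_{n,j})$ and $\gamma_\alpha=\left(\frac12\left(t_k^\alpha+t_j^\alpha-|t_k-t_j|^\alpha\right)\right)_{k,j=1}^n$; (3) whenever $\gamma_\alpha$ is invertible, the joint probability density function of $(B_{\beta,\alpha}(t_1),\dots,B_{\beta,\alpha}(t_n))$ at $\theta\in(\mathbb{R}^d)^n$ is $$\frac{(2\pi)^{-nd/2}}{(\det\gamma_\alpha)^{d/2}}\int_0^\infty\tau^{-nd/2}\exp\left(-\frac{1}{2\tau}\sum_{j=1}^d(\theta_{\cdot,j},\gamma_\alpha^{-1}\theta_{\cdot,j})_{\mathbb{R}^n}\right)M_\beta(\tau)\,\mathrm{d}\tau.$$ In particular, for $t>0$ the density of $B_{\beta,\alpha}(t)$ is $y\mapsto(2\pi t^\alpha)^{-d/2}\int_0^\infty\tau^{-d/2}e^{-|y|^2/(2t^\alpha\tau)}M_\beta(\tau)\,\mathrm{d}\tau$. *)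

theory Defs
  imports "HOL-Probability.Probability" "Jordan_Normal_Form.Determinant"
begin

no_notation Matrix.vec_index (infixl \<open>$\<close> 100)
no_notation Matrix.scalar_prod (infix \<open>\<bullet>\<close> 70)

definition mittag_leffler :: "real \<Rightarrow> complex \<Rightarrow> complex" where
  "mittag_leffler \<beta> z = (\<Sum>n. z ^ n / Gamma (of_real (\<beta> * real n + 1)))"

(* rGamma is the entire function 1 / Gamma, so the terms at the poles of Gamma are 0. *)
definition M_Wright :: "real \<Rightarrow> real \<Rightarrow> real" where
  "M_Wright \<beta> z = (\<Sum>n. (- z) ^ n / fact n * rGamma (- \<beta> * real n + 1 - \<beta>))"

text \<open>The measure written $M_\beta(\tau)\,d\tau$ on $[0,\infty)$. For $0 < \beta < 1$ the function
  $M_\beta$ is nonnegative there, so that \<^const>\<open>ennreal\<close> does not truncate anything.\<close>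

definition M_Wright_measure :: "real \<Rightarrow> real measure" where
  "M_Wright_measure \<beta> =
     (if \<beta> = 1 then return borel 1
      else density lborel (\<lambda>\<tau>. indicator {0..} \<tau> * ennreal (M_Wright \<beta> \<tau>)))"

definition ggBm_cov :: "real \<Rightarrow> nat \<Rightarrow> (nat \<Rightarrow> real) \<Rightarrow> real mat" where
  "ggBm_cov \<alpha> n t =
     mat n n (\<lambda>(k, j). (t k powr \<alpha> + t j powr \<alpha> - \<bar>t k - t j\<bar> powr \<alpha>) / 2)"

text \<open>For $\theta = (\theta_0,\dots,\theta_{n-1}) \in (\mathbb{R}^d)^n$ and an $n \times n$ matrix $A$,
  the sum over the coordinates $j$ of $(\theta_{\cdot,j}, A\,\theta_{\cdot,j})_{\mathbb{R}^n}$.\<close>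

definition coord_quad_form :: "nat \<Rightarrow> real mat \<Rightarrow> (nat \<Rightarrow> real ^ 'd) \<Rightarrow> real" where
  "coord_quad_form n A \<theta> =
     (\<Sum>j\<in>UNIV. let v = vec n (\<lambda>k. \<theta> k $ j) in scalar_prod v (A *\<^sub>v v))"

text \<open>The joint density of $(B(t_0),\dots,B(t_{n-1}))$, where \<open>H\<close> stands for the inverse
  of the matrix \<open>G\<close>. It takes values in $[0,\infty]$: the integral may diverge
  on a null set, for instance at $\theta = 0$.\<close>

definition ggBm_density ::
    "real \<Rightarrow> nat \<Rightarrow> real mat \<Rightarrow> real mat \<Rightarrow> (nat \<Rightarrow> real ^ 'd) \<Rightarrow> ennreal" where
  "ggBm_density \<beta> n G H \<theta> =
     ennreal ((2 * pi) powr (- (real n * real CARD('d) / 2)) / det G powr (real CARD('d) / 2)) *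
     (\<integral>\<^sup>+\<tau>. ennreal (\<tau> powr (- (real n * real CARD('d) / 2)) *
                  exp (- (1 / (2 * \<tau>)) * coord_quad_form n H \<theta>)) \<partial>M_Wright_measure \<beta>)"

text \<open>Continuity of the paths is only required almost surely. Only the values of \<open>B\<close> at times
  $t \ge 0$ matter. The time points are indexed from 0 to $n - 1$.\<close>

definition ggBm ::
    "'w measure \<Rightarrow> real \<Rightarrow> real \<Rightarrow> (real \<Rightarrow> 'w \<Rightarrow> real ^ 'd) \<Rightarrow> bool" where
  "ggBm M \<beta> \<alpha> B \<longleftrightarrow>
     prob_space M \<and> complete_measure M \<and> 0 < \<beta> \<and> \<beta> \<le> 1 \<and> 0 < \<alpha> \<and> \<alpha> \<le> 2 \<and>
     (\<forall>t\<ge>0. B t \<in> borel_measurable M) \<and>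
     (AE \<omega> in M. continuous_on {0..} (\<lambda>t. B t \<omega>)) \<and>
     measure M {\<omega> \<in> space M. B 0 \<omega> = 0} = 1 \<and>
     (\<forall>n t. 1 \<le> n \<longrightarrow> 0 \<le> t 0 \<longrightarrow> strict_mono_on {..<n} t \<longrightarrow>
        (\<forall>\<theta> :: nat \<Rightarrow> real ^ 'd.
           (LINT \<omega>|M. exp (\<i> * of_real (\<Sum>k<n. inner (\<theta> k) (B (t k) \<omega>)))) =
           mittag_leffler \<beta> (of_real (- (1 / 2) * coord_quad_form n (ggBm_cov \<alpha> n t) \<theta>))) \<and>
        (\<forall>H \<in> carrier_mat n n.
           inverts_mat (ggBm_cov \<alpha> n t) H \<and> inverts_mat H (ggBm_cov \<alpha> n t) \<longrightarrow>
           distributed M (\<Pi>\<^sub>M k\<in>{..<n}. lborel) (\<lambda>\<omega>. \<lambda>k\<in>{..<n}. B (t k) \<omega>)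
             (ggBm_density \<beta> n (ggBm_cov \<alpha> n t) H)))"

definition CL :: "(real ^ 'd \<Rightarrow> real) set" where
  "CL = {f. continuous_on UNIV f \<and> bounded (range f) \<and> integrable lborel f}"

definition perpetual_const :: "real \<Rightarrow> real \<Rightarrow> nat \<Rightarrow> real" where
  "perpetual_const \<beta> \<alpha> d =
     1 / \<alpha> * 2 powr (- (1 / \<alpha>)) * pi powr (- (real d / 2)) * Gamma (real d / 2 - 1 / \<alpha>) *
     (Gamma (1 - 1 / \<alpha>) / Gamma (1 - \<beta> / \<alpha>))"

end

theory Submission
  imports Defs "HOL-Complex_Analysis.Cauchy_Integral_Formula"
begin

text \<open>
  Write $\mu = M_\beta(\tau)\,d\tau$ and let $g_v$ be the density of a centred Gaussian vector in
  $\mathbb{R}^d$ with covariance $v$ times the identity. The one-point density of the process is the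
  mixture $p_t = \int g_{t^\alpha \tau}\,\mu(d\tau)$. By Tonelli, the expected time that the process
  spends near $y$ has density $\int_0^\infty p_t(y)\,dt$, and two integrations evaluate it.
  The time integral of $g_{t^\alpha\tau}(y)$ is a Gamma integral, equal to a constant times
  $|y|^{2/\alpha - d}\,\tau^{-1/\alpha}$ (\<open>gauss_time_integral\<close>); the condition $d\alpha > 2$ makes it
  converge. What remains is the moment of order $-1/\alpha$ of \<open>\<mu>\<close>, which is
  $\Gamma(1-1/\alpha)/\Gamma(1-\beta/\alpha)$ (\<open>ggBm_M_Wright_moment\<close>). The result is the occupation
  formula \<open>ggBm_occupation_formula\<close> for nonnegative test functions; the theorem is its
  signed form, applied to the positive and negative parts of $f(x + \cdot)$.

  All information about \<open>\<mu>\<close> is read off from the process, which has both the mixture density and the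
  characteristic function $E_\beta(-\frac12 t^\alpha |\theta|^2)$. Comparing the two at $t = 1$ shows that
  \<open>\<mu>\<close> is a probability measure with Laplace transform $s \mapsto E_\beta(-s)$
  (\<open>ggBm_laplace_M_Wright\<close>).

  For the moment, let $X$ have law \<open>\<mu>\<close> and let $U$ be an independent standard exponential variable.
  Since $E[U^{\beta n}] = \Gamma(\beta n + 1)$ cancels the denominators of the Mittag-Leffler series,
  $Y = U^\beta X$ satisfies $E[e^{-zY}] = \sum_n (-z)^n = 1/(1+z)$ for $0 < z < 1$. A Laplace
  transform is a power series around every $a > 0$ with radius of convergence at least $a$, so that
  the identity extends to all $z > 0$ (\<open>exponential_laplace_extend\<close>): $Y$ is again
  standard exponential. Comparing moments of order $-c$ in $Y^{-c} = U^{-\beta c} X^{-c}$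
  gives $E[X^{-c}] = \Gamma(1-c)/\Gamma(1-\beta c)$ (\<open>mittag_leffler_negative_moment\<close>).

  Integrability of $f(x+y)/|y|^{d-2/\alpha}$ also comes from the time integral, with \<open>\<tau> = 1\<close>:
  times $t \le 1$ contribute at most $\sup |f|$, and at times $t \ge 1$ the Gaussian density
  is at most a constant times $t^{-\alpha d/2}$, an integrable bound (\<open>integrable_riesz_potential\<close>).
\<close>

section \<open>Continuation of Laplace transforms\<close>

lemma power_series_unique:
  fixes a b :: "nat \<Rightarrow> real"
  assumes r: "0 < r"
    and a: "\<And>x. \<bar>x\<bar> < r \<Longrightarrow> (\<lambda>n. a n * x ^ n) sums f x"
    and b: "\<And>x. \<bar>x\<bar> < r \<Longrightarrow> (\<lambda>n. b n * x ^ n) sums f x"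
  shows "a n = b n"
proof (rule ccontr)
  assume ne: "a n \<noteq> b n"
  define c where "c n = a n - b n" for n
  have c: "(\<lambda>n. c n * x ^ n) sums 0" if "\<bar>x\<bar> < r" for x
    using sums_diff[OF a[OF that] b[OF that]] by (simp add: c_def algebra_simps)
  have "c 0 = 0"
    using c[of 0] r by simp
  moreover have "c n \<noteq> 0" using ne by (simp add: c_def)
  moreover from calculation have "n > 0" by (cases n) auto
  ultimately have "\<exists>s>0. \<forall>z\<in>cball 0 s - {0 :: real}. (\<lambda>_. 0 :: real) z \<noteq> 0"
    using powser_0_nonzero[where r = r and a = c and \<xi> = 0 and f = "\<lambda>_. 0" and m = n] r c
    by (metis diff_zero real_norm_def)
  then obtain s :: real where s: "0 < s" "\<forall>z\<in>cball 0 s - {0 :: real}. False" by auto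
  have "\<bar>s\<bar> \<le> s" "s \<noteq> 0" using s(1) by auto
  then have "s \<in> cball 0 s - {0}" by (simp only: mem_cball Diff_iff dist_norm) simp
  with s(2) show False by blast
qed

lemma power_over_fact_le_exp:
  fixes x :: real
  assumes "0 \<le> x"
  shows "x ^ n / fact n \<le> exp x"
proof -
  have "(\<Sum>k\<in>{n}. x ^ k / fact k) \<le> (\<Sum>k. x ^ k / fact k)"
    using summable_exp[of x] assms by (intro sum_le_suminf) (auto simp: field_simps)
  then show ?thesis
    by (simp add: exp_def field_simps)
qed

lemma exp_partial_sum_le:
  fixes x :: real
  shows "\<bar>\<Sum>k<n. x ^ k / fact k\<bar> \<le> exp \<bar>x\<bar>"
proof -
  have "\<bar>\<Sum>k<n. x ^ k / fact k\<bar> \<le> (\<Sum>k<n. \<bar>x\<bar> ^ k / fact k)"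
    by (rule order.trans[OF sum_abs]) (simp add: power_abs)
  also have "\<dots> \<le> (\<Sum>k. \<bar>x\<bar> ^ k / fact k)"
    using summable_exp[of "\<bar>x\<bar>"] by (intro sum_le_suminf) (auto simp: field_simps)
  finally show ?thesis
    by (simp add: exp_def field_simps)
qed

text \<open>The Taylor expansion of a Laplace transform around $a$. The interchange of sum and integral is
  dominated: the partial sums of $e^{hY}$ are at most $e^{|h|Y} \le e^{aY}$, which the factor $e^{-aY}$
  compensates. This is why the radius of convergence is at least $a$.\<close>
lemma (in finite_measure) laplace_power_series:
  fixes Y :: "'a \<Rightarrow> real"
  assumes [measurable]: "Y \<in> borel_measurable M" and Y: "AE \<omega> in M. 0 \<le> Y \<omega>" and h: "\<bar>h\<bar> < a"
  shows "(\<lambda>n. (LINT \<omega>|M. exp (- a * Y \<omega>) * Y \<omega> ^ n / fact n) * h ^ n)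
           sums (LINT \<omega>|M. exp (- (a - h) * Y \<omega>))"
proof -
  define S where "S n \<omega> = (\<Sum>k<n. exp (- a * Y \<omega>) * Y \<omega> ^ k / fact k * h ^ k)" for n \<omega>
  have S: "S n \<omega> = exp (- a * Y \<omega>) * (\<Sum>k<n. (h * Y \<omega>) ^ k / fact k)" for n \<omega>
    by (simp add: S_def sum_distrib_left power_mult_distrib algebra_simps)
  have "a > 0" using h by linarith
  have int: "integrable M (\<lambda>\<omega>. exp (- a * Y \<omega>) * Y \<omega> ^ n / fact n)" for n
  proof (rule integrable_const_bound[where B = "1 / a ^ n"])
    show "AE \<omega> in M. norm (exp (- a * Y \<omega>) * Y \<omega> ^ n / fact n) \<le> 1 / a ^ n"
      using Y
    proof eventually_elim
      fix \<omega> assume Y: "0 \<le> Y \<omega>"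
      with power_over_fact_le_exp[of "a * Y \<omega>" n] \<open>a > 0\<close>
      have "a ^ n * (Y \<omega> ^ n / fact n) \<le> exp (a * Y \<omega>)"
        by (simp add: power_mult_distrib)
      then have "exp (- a * Y \<omega>) * (a ^ n * (Y \<omega> ^ n / fact n)) \<le> exp (- a * Y \<omega>) * exp (a * Y \<omega>)"
        by (intro mult_left_mono) auto
      also have "\<dots> = 1" by (simp add: exp_minus)
      finally show "norm (exp (- a * Y \<omega>) * Y \<omega> ^ n / fact n) \<le> 1 / a ^ n"
        using \<open>a > 0\<close> Y by (simp add: field_simps)
    qed
  qed simp
  have "(\<lambda>n. LINT \<omega>|M. S n \<omega>) \<longlonglongrightarrow> (LINT \<omega>|M. exp (- (a - h) * Y \<omega>))"
  proof (rule integral_dominated_convergence[where w = "\<lambda>_. 1"])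
    show "AE \<omega> in M. (\<lambda>n. S n \<omega>) \<longlonglongrightarrow> exp (- (a - h) * Y \<omega>)"
    proof (rule AE_I2)
      fix \<omega>
      have "(\<lambda>k. (h * Y \<omega>) ^ k / fact k) sums exp (h * Y \<omega>)"
        using exp_converges[of "h * Y \<omega>"] by (simp add: field_simps)
      then have "(\<lambda>n. exp (- a * Y \<omega>) * (\<Sum>k<n. (h * Y \<omega>) ^ k / fact k))
          \<longlonglongrightarrow> exp (- a * Y \<omega>) * exp (h * Y \<omega>)"
        by (intro tendsto_intros) (simp add: sums_def)
      also have "exp (- a * Y \<omega>) * exp (h * Y \<omega>) = exp (- (a - h) * Y \<omega>)"
        by (simp add: exp_add[symmetric] algebra_simps)
      finally show "(\<lambda>n. S n \<omega>) \<longlonglongrightarrow> exp (- (a - h) * Y \<omega>)"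
        by (simp add: S)
    qed
    show "AE \<omega> in M. norm (S n \<omega>) \<le> 1" for n
      using Y
    proof eventually_elim
      fix \<omega> assume Y: "0 \<le> Y \<omega>"
      have "norm (S n \<omega>) \<le> exp (- a * Y \<omega>) * exp \<bar>h * Y \<omega>\<bar>"
        unfolding S real_norm_def abs_mult[of "exp _"] abs_exp_cancel
        by (intro mult_left_mono exp_partial_sum_le) simp
      also have "\<dots> = exp (- (a - \<bar>h\<bar>) * Y \<omega>)"
        using Y by (simp add: exp_add[symmetric] algebra_simps abs_mult)
      also have "\<dots> \<le> 1"
        using Y h mult_nonpos_nonneg[of "\<bar>h\<bar> - a" "Y \<omega>"] by simp
      finally show "norm (S n \<omega>) \<le> 1" .
    qed
    show "S n \<in> borel_measurable M" for n
      unfolding S_def by measurable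
  qed auto
  moreover have "(LINT \<omega>|M. S n \<omega>) = (\<Sum>k<n. (LINT \<omega>|M. exp (- a * Y \<omega>) * Y \<omega> ^ k / fact k) * h ^ k)" for n
    unfolding S_def
    by (subst Bochner_Integration.integral_sum) (rule integrable_mult_left, rule int, simp)
  ultimately show ?thesis
    by (simp add: sums_def)
qed

text \<open>Analytic continuation along the positive axis in elementary form. If the identity is known
  on $(0,b)$, then the two Taylor series around $a = \frac34 b$ agree near $a$, hence on all of
  $(0, 2a) = (0, \frac32 b)$; repeating this exhausts the axis.\<close>
lemma (in finite_measure) exponential_laplace_extend:
  fixes Y :: "'a \<Rightarrow> real"
  assumes [measurable]: "Y \<in> borel_measurable M" and Y: "AE \<omega> in M. 0 \<le> Y \<omega>"
    and F: "\<And>z. 0 < z \<Longrightarrow> z < 1 \<Longrightarrow> (LINT \<omega>|M. exp (- z * Y \<omega>)) = 1 / (1 + z)"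
    and z: "0 < z"
  shows "(LINT \<omega>|M. exp (- z * Y \<omega>)) = 1 / (1 + z)"
proof -
  define P where "P b \<longleftrightarrow> (\<forall>z. 0 < z \<and> z < b \<longrightarrow> (LINT \<omega>|M. exp (- z * Y \<omega>)) = 1 / (1 + z))" for b
  have step: "P (3 / 2 * b)" if "P b" "0 < b" for b
  proof -
    \<comment> \<open>Any point of \<open>(b/2, b)\<close> would do: then \<open>2 * a > b\<close>. For this one, the radius \<open>b / 4\<close> below keeps \<open>a - h\<close> in \<open>(0, b)\<close>.\<close>
    define a where "a = 3 / 4 * b"
    have a: "0 < a" using that by (simp add: a_def)
    define A where "A n = (LINT \<omega>|M. exp (- a * Y \<omega>) * Y \<omega> ^ n / fact n)" for n
    have A: "(\<lambda>n. A n * h ^ n) sums (LINT \<omega>|M. exp (- (a - h) * Y \<omega>))" if "\<bar>h\<bar> < a" for h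
      unfolding A_def using laplace_power_series[OF _ Y that] by simp
    have G: "(\<lambda>n. (1 / (1 + a) ^ Suc n) * h ^ n) sums (1 / (1 + (a - h)))" if "\<bar>h\<bar> < a" for h
    proof -
      have "(\<lambda>n. (1 / (1 + a)) * (h / (1 + a)) ^ n) sums ((1 / (1 + a)) * (1 / (1 - h / (1 + a))))"
        using that a by (intro sums_mult geometric_sums) (simp add: field_simps)
      moreover have "(1 / (1 + a)) * (1 / (1 - h / (1 + a))) = 1 / (1 + (a - h))"
        using that a by (simp add: field_simps)
      ultimately show ?thesis
        by (simp add: power_divide field_simps)
    qed
    have AG: "A n = 1 / (1 + a) ^ Suc n" for n
    proof (rule power_series_unique[where a = A and b = "\<lambda>n. 1 / (1 + a) ^ Suc n"])
      show "0 < b / 4" using that by simp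
      show "(\<lambda>n. A n * h ^ n) sums (1 / (1 + (a - h)))" if "\<bar>h\<bar> < b / 4" for h
      proof -
        have "0 < a - h" "a - h < b" using that by (auto simp: a_def)
        then have "(LINT \<omega>|M. exp (- (a - h) * Y \<omega>)) = 1 / (1 + (a - h))"
          using \<open>P b\<close> unfolding P_def by blast
        moreover have "\<bar>h\<bar> < a" using that by (simp add: a_def)
        ultimately show ?thesis using A[of h] by simp
      qed
      show "(\<lambda>n. 1 / (1 + a) ^ Suc n * h ^ n) sums (1 / (1 + (a - h)))" if "\<bar>h\<bar> < b / 4" for h
        using that by (intro G) (simp add: a_def)
    qed
    show ?thesis
      unfolding P_def
    proof safe
      fix z assume z: "0 < z" "z < 3 / 2 * b"
      then have h: "\<bar>a - z\<bar> < a" unfolding a_def abs_less_iff by linarith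
      from sums_unique2[OF A[OF h] G[OF h, folded AG]]
      show "(LINT \<omega>|M. exp (- z * Y \<omega>)) = 1 / (1 + z)" by simp
    qed
  qed
  have P: "P ((3 / 2) ^ n)" for n
  proof (induction n)
    case 0 show ?case using F by (simp add: P_def)
  next
    case (Suc n)
    from step[OF this] show ?case by simp
  qed
  obtain n where "z < (3 / 2) ^ n"
    using real_arch_pow[of "3 / 2" z] by auto
  with P[of n] z show ?thesis by (simp add: P_def)
qed

section \<open>Negative moments and the exponential distribution\<close>

lemma Gamma_nn_integral_scaled:
  fixes y :: real
  assumes c: "0 < c" and y: "0 < y"
  shows "(\<integral>\<^sup>+z. ennreal (indicator {0<..} z * z powr (c - 1) * exp (- z * y)) \<partial>lborel)
     = ennreal (Gamma c * y powr (- c))"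
proof -
  have "ennreal (Gamma c) = (\<integral>\<^sup>+t. ennreal (indicator {0..} t * t powr (c - 1) / exp t) \<partial>lborel)"
    by (rule Gamma_conv_nn_integral_real[OF c])
  also have "\<dots> = ennreal \<bar>y\<bar> * (\<integral>\<^sup>+z. ennreal (indicator {0..} (0 + y * z) * (0 + y * z) powr (c - 1) / exp (0 + y * z)) \<partial>lborel)"
    using y by (intro nn_integral_real_affine) auto
  also have "(\<integral>\<^sup>+z. ennreal (indicator {0..} (0 + y * z) * (0 + y * z) powr (c - 1) / exp (0 + y * z)) \<partial>lborel)
     = (\<integral>\<^sup>+z. ennreal (y powr (c - 1)) * ennreal (indicator {0<..} z * z powr (c - 1) * exp (- z * y)) \<partial>lborel)"
    using y by (intro nn_integral_cong)
      (auto simp: indicator_def powr_mult ennreal_mult'[symmetric] exp_minus field_simps zero_le_mult_iff)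
  also have "\<dots> = ennreal (y powr (c - 1)) * (\<integral>\<^sup>+z. ennreal (indicator {0<..} z * z powr (c - 1) * exp (- z * y)) \<partial>lborel)"
    by (rule nn_integral_cmult) auto
  finally have "ennreal (Gamma c) = ennreal (y * y powr (c - 1)) * (\<integral>\<^sup>+z. ennreal (indicator {0<..} z * z powr (c - 1) * exp (- z * y)) \<partial>lborel)" (is "_ = _ * ?I")
    using y by (simp add: ennreal_mult' mult.assoc)
  then have "ennreal (y powr (- c)) * ennreal (Gamma c) = ennreal (y powr (-c)) * (ennreal (y * y powr (c - 1)) * ?I)"
    by simp
  also have "\<dots> = ennreal (y powr (-c) * (y * y powr (c - 1))) * ?I"
    by (simp add: ennreal_mult' mult.assoc)
  also have "y powr (-c) * (y * y powr (c - 1)) = 1"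
    using y by (simp add: powr_mult_base powr_add[symmetric])
  finally have "ennreal (y powr (- c)) * ennreal (Gamma c) = ?I"
    by simp
  then show ?thesis
    using c by (simp only: ennreal_mult'[symmetric] mult.commute[of "Gamma c"] powr_ge_zero)
qed

text \<open>Integrating $e^{-zY}$ against $z^{c-1}\,dz$ turns the Laplace transform of \<open>Y\<close> into its
  moment of order $-c$.\<close>
lemma (in sigma_finite_measure) mellin_laplace:
  fixes Y :: "'a \<Rightarrow> real"
  assumes [measurable]: "Y \<in> borel_measurable M" and Y: "AE \<omega> in M. 0 < Y \<omega>" and c: "0 < c"
  shows "(\<integral>\<^sup>+z. ennreal (indicator {0<..} z * z powr (c - 1)) * (\<integral>\<^sup>+\<omega>. ennreal (exp (- z * Y \<omega>)) \<partial>M) \<partial>lborel)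
     = ennreal (Gamma c) * (\<integral>\<^sup>+\<omega>. ennreal (Y \<omega> powr (- c)) \<partial>M)"
proof -
  interpret pair_sigma_finite M "lborel :: real measure" ..
  have "(\<integral>\<^sup>+z. ennreal (indicator {0<..} z * z powr (c - 1)) * (\<integral>\<^sup>+\<omega>. ennreal (exp (- z * Y \<omega>)) \<partial>M) \<partial>lborel)
    = (\<integral>\<^sup>+z. \<integral>\<^sup>+\<omega>. ennreal (indicator {0<..} z * z powr (c - 1) * exp (- z * Y \<omega>)) \<partial>M \<partial>lborel)"
    by (subst nn_integral_cmult[symmetric]) (auto simp: ennreal_mult')
  also have "\<dots> = (\<integral>\<^sup>+\<omega>. \<integral>\<^sup>+z. ennreal (indicator {0<..} z * z powr (c - 1) * exp (- z * Y \<omega>)) \<partial>lborel \<partial>M)"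
    by (rule Fubini') measurable
  also have "\<dots> = (\<integral>\<^sup>+\<omega>. ennreal (Gamma c) * ennreal (Y \<omega> powr (- c)) \<partial>M)"
  proof (rule nn_integral_cong_AE)
    show "AE \<omega> in M. (\<integral>\<^sup>+z. ennreal (indicator {0<..} z * z powr (c - 1) * exp (- z * Y \<omega>)) \<partial>lborel)
        = ennreal (Gamma c) * ennreal (Y \<omega> powr (- c))"
      using Y by eventually_elim
        (subst Gamma_nn_integral_scaled[OF c], use c in \<open>simp_all add: ennreal_mult' Gamma_real_pos less_imp_le\<close>)
  qed
  finally show ?thesis
    by (simp add: nn_integral_cmult)
qed

abbreviation std_exponential :: "real measure" where
  "std_exponential \<equiv> density lborel (exponential_density 1)"

lemma nn_integral_std_exponential:
  assumes [measurable]: "g \<in> borel_measurable borel"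
  shows "(\<integral>\<^sup>+u. g u \<partial>std_exponential) = (\<integral>\<^sup>+u. ennreal (indicator {0<..} u * exp (- u)) * g u \<partial>lborel)"
proof -
  have "(\<integral>\<^sup>+u. g u \<partial>std_exponential) = (\<integral>\<^sup>+u. ennreal (exponential_density 1 u) * g u \<partial>lborel)"
    by (rule nn_integral_density) auto
  also have "\<dots> = (\<integral>\<^sup>+u. ennreal (indicator {0<..} u * exp (- u)) * g u \<partial>lborel)"
    using AE_lborel_singleton[of 0]
    by (intro nn_integral_cong_AE) (auto elim!: eventually_mono simp: exponential_density_def indicator_def)
  finally show ?thesis .
qed

lemma AE_std_exponential: "AE u in std_exponential. 0 < u"
proof (subst AE_density)
  show "AE u in lborel. 0 < ennreal (exponential_density 1 u) \<longrightarrow> 0 < u"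
    using AE_lborel_singleton[of 0]
    by eventually_elim (auto simp: exponential_density_def not_less split: if_splits)
qed auto

lemma std_exponential_moment:
  assumes "0 < a"
  shows "(\<integral>\<^sup>+u. ennreal (u powr (a - 1)) \<partial>std_exponential) = ennreal (Gamma a)"
  using Gamma_nn_integral_scaled[OF assms, of 1]
  by (subst nn_integral_std_exponential) (auto simp: ennreal_mult'[symmetric] mult_ac)

lemma std_exponential_laplace:
  assumes "0 < z"
  shows "(\<integral>\<^sup>+u. ennreal (exp (- z * u)) \<partial>std_exponential) = ennreal (1 / (1 + z))"
proof -
  have "(\<integral>\<^sup>+u. ennreal (exp (- z * u)) \<partial>std_exponential) =
     (\<integral>\<^sup>+u. ennreal (indicator {0<..} u * u powr (1 - 1) * exp (- u * (1 + z))) \<partial>lborel)"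
    by (subst nn_integral_std_exponential)
      (auto intro!: nn_integral_cong simp: ennreal_mult'[symmetric] exp_add[symmetric] indicator_def algebra_simps)
  also have "\<dots> = ennreal (Gamma 1 * (1 + z) powr (- 1))"
    using assms by (intro Gamma_nn_integral_scaled) auto
  finally show ?thesis
    using assms by (simp add: powr_minus_divide)
qed

text \<open>The moment of order $-c$ depends on the Laplace transform only, so it may be computed
  for the standard exponential distribution itself.\<close>
lemma (in prob_space) exponential_negative_moment:
  fixes Y :: "'a \<Rightarrow> real"
  assumes [measurable]: "Y \<in> borel_measurable M" and Y: "AE \<omega> in M. 0 < Y \<omega>"
    and F: "\<And>z. 0 < z \<Longrightarrow> z < 1 \<Longrightarrow> expectation (\<lambda>\<omega>. exp (- z * Y \<omega>)) = 1 / (1 + z)"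
    and c: "0 < c" "c < 1"
  shows "(\<integral>\<^sup>+\<omega>. ennreal (Y \<omega> powr (- c)) \<partial>M) = ennreal (Gamma (1 - c))"
proof -
  interpret E: prob_space std_exponential
    by (rule prob_space_exponential_density) simp
  have Y0: "AE \<omega> in M. 0 \<le> Y \<omega>" using Y by eventually_elim simp
  have L: "(\<integral>\<^sup>+\<omega>. ennreal (exp (- z * Y \<omega>)) \<partial>M) = ennreal (1 / (1 + z))" if "0 < z" for z
  proof (subst nn_integral_eq_integral)
    show "integrable M (\<lambda>\<omega>. exp (- z * Y \<omega>))"
      using that Y0 by (intro integrable_const_bound[where B = 1]) (auto elim!: eventually_mono)
    show "ennreal (expectation (\<lambda>\<omega>. exp (- z * Y \<omega>))) = ennreal (1 / (1 + z))"
      using exponential_laplace_extend[OF _ Y0 F that] by simp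
  qed auto
  have "ennreal (Gamma c) * (\<integral>\<^sup>+\<omega>. ennreal (Y \<omega> powr (- c)) \<partial>M)
      = (\<integral>\<^sup>+z. ennreal (indicator {0<..} z * z powr (c - 1)) * (\<integral>\<^sup>+\<omega>. ennreal (exp (- z * Y \<omega>)) \<partial>M) \<partial>lborel)"
    by (rule mellin_laplace[symmetric]) (use Y c in auto)
  also have "\<dots> = (\<integral>\<^sup>+z. ennreal (indicator {0<..} z * z powr (c - 1)) * (\<integral>\<^sup>+u. ennreal (exp (- z * u)) \<partial>std_exponential) \<partial>lborel)"
    by (intro nn_integral_cong) (auto simp: indicator_def L[simplified] std_exponential_laplace[simplified])
  also have "\<dots> = ennreal (Gamma c) * (\<integral>\<^sup>+u. ennreal (u powr (- c)) \<partial>std_exponential)"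
    by (rule E.mellin_laplace) (use AE_std_exponential c in auto)
  also have "(\<integral>\<^sup>+u. ennreal (u powr (- c)) \<partial>std_exponential) = ennreal (Gamma (1 - c))"
    using std_exponential_moment[of "1 - c"] c by simp
  finally show ?thesis
    using Gamma_real_pos[OF c(1)] by (simp add: ennreal_mult_cancel_left)
qed

section \<open>The Mittag-Leffler function as a Laplace transform\<close>

lemma std_exponential_power:
  assumes "0 \<le> b"
  shows "integrable std_exponential (\<lambda>u. u powr b)"
    and "(LINT u|std_exponential. u powr b) = Gamma (b + 1)"
proof -
  have "(\<integral>\<^sup>+u. ennreal (u powr b) \<partial>std_exponential) = ennreal (Gamma (b + 1))"
    using std_exponential_moment[of "b + 1"] assms by simp
  moreover have "Gamma (b + 1) \<ge> 0"
    using assms Gamma_real_pos[of "b + 1"] by simp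
  ultimately have "integrable std_exponential (\<lambda>u. u powr b) \<and> (LINT u|std_exponential. u powr b) = Gamma (b + 1)"
    by (subst (asm) nn_integral_eq_integrable) auto
  then show "integrable std_exponential (\<lambda>u. u powr b)"
    and "(LINT u|std_exponential. u powr b) = Gamma (b + 1)" by auto
qed

lemma AE_lborel_pos_witness_above:
  assumes "AE u in lborel. (0::real) < u \<longrightarrow> P u"
  shows "\<exists>u>K. P u"
proof (rule ccontr)
  assume "\<not> ?thesis"
  with assms have "AE u in lborel. u \<notin> {max 0 K<..<max 0 K + 1}"
    by (auto elim!: eventually_mono)
  then have "emeasure lborel {max 0 K<..<max 0 K + 1} = 0"
    by (subst (asm) AE_iff_measurable[where N = "{max 0 K<..<max 0 K + 1}"]) auto
  then show False by simp
qed

text \<open>Integrating the series at $u^\beta / 2$ against $e^{-u}\,du$ gives $\sum_n 2^{-n} < \infty$, so it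
  converges for almost every \<open>u\<close>, in particular for arbitrarily large ones, and these dominate
  every given argument.\<close>
lemma summable_mittag_leffler:
  fixes \<beta> s :: real
  assumes "0 < \<beta>"
  shows "summable (\<lambda>n. \<bar>s\<bar> ^ n / Gamma (\<beta> * real n + 1))"
proof -
  have G: "Gamma (\<beta> * real n + 1) > 0" for n
    using assms by (intro Gamma_real_pos) (simp add: add_nonneg_pos)
  \<comment> \<open>The terms at argument \<open>u powr \<beta> / 2\<close>; the factor 1/2 could be any number below 1.\<close>
  define t where "t n u = (1 / 2) ^ n * u powr (\<beta> * real n) / Gamma (\<beta> * real n + 1)" for n u
  have t: "0 \<le> t n u" for n u using G[of n] by (simp add: t_def)
  have "(\<integral>\<^sup>+u. (\<Sum>n. ennreal (t n u)) \<partial>std_exponential) = (\<Sum>n. \<integral>\<^sup>+u. ennreal (t n u) \<partial>std_exponential)"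
    unfolding t_def by (rule nn_integral_suminf) auto
  also have "\<dots> = (\<Sum>n. ennreal ((1 / 2) ^ n))"
  proof (rule suminf_cong)
    fix n
    have "(\<integral>\<^sup>+u. ennreal (t n u) \<partial>std_exponential)
        = (\<integral>\<^sup>+u. ennreal ((1 / 2) ^ n / Gamma (\<beta> * real n + 1)) * ennreal (u powr (\<beta> * real n + 1 - 1)) \<partial>std_exponential)"
      using G[of n] by (intro nn_integral_cong) (simp add: t_def ennreal_mult'[symmetric])
    also have "\<dots> = ennreal ((1 / 2) ^ n / Gamma (\<beta> * real n + 1)) * ennreal (Gamma (\<beta> * real n + 1))"
      using assms by (subst nn_integral_cmult, simp, subst std_exponential_moment) (auto simp: add_nonneg_pos)
    also have "\<dots> = ennreal ((1 / 2) ^ n)"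
      using G[of n] by (simp add: ennreal_mult'[symmetric])
    finally show "(\<integral>\<^sup>+u. ennreal (t n u) \<partial>std_exponential) = ennreal ((1 / 2) ^ n)" .
  qed
  also have "\<dots> < \<infinity>"
    by (subst suminf_ennreal2) (auto simp: summable_geometric)
  finally have fin: "(\<integral>\<^sup>+u. (\<Sum>n. ennreal (t n u)) \<partial>std_exponential) \<noteq> \<infinity>" by simp
  have "AE u in std_exponential. (\<Sum>n. ennreal (t n u)) \<noteq> \<infinity>"
    by (rule nn_integral_PInf_AE[OF _ fin]) (simp add: t_def)
  then have "AE u in lborel. 0 < ennreal (exponential_density 1 u) \<longrightarrow> (\<Sum>n. ennreal (t n u)) \<noteq> \<infinity>"
    by (subst (asm) AE_density) auto
  then have "AE u in lborel. 0 < u \<longrightarrow> (\<Sum>n. ennreal (t n u)) \<noteq> \<infinity>"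
    by eventually_elim (auto simp: exponential_density_def)
  from AE_lborel_pos_witness_above[OF this, of "max 1 (2 * \<bar>s\<bar>) powr (1 / \<beta>)"]
  obtain u where u: "u > max 1 (2 * \<bar>s\<bar>) powr (1 / \<beta>)" and fin: "(\<Sum>n. ennreal (t n u)) \<noteq> \<infinity>"
    by blast
  have sum: "summable (\<lambda>n. t n u)"
    by (rule summable_suminf_not_top) (use t fin in auto)
  have "0 < max 1 (2 * \<bar>s\<bar>) powr (1 / \<beta>)" by auto
  with u have u0: "0 < u" by linarith
  have "max 1 (2 * \<bar>s\<bar>) = (max 1 (2 * \<bar>s\<bar>) powr (1 / \<beta>)) powr \<beta>"
    using assms by (simp add: powr_powr)
  also have "\<dots> \<le> u powr \<beta>"
    using u assms by (intro powr_mono2) auto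
  finally have s: "\<bar>s\<bar> \<le> (1 / 2) * u powr \<beta>" by simp
  show ?thesis
  proof (rule summable_comparison_test[OF _ sum], intro exI allI impI)
    fix n :: nat
    have "\<bar>s\<bar> ^ n \<le> ((1 / 2) * u powr \<beta>) ^ n"
      by (intro power_mono s) auto
    also have "\<dots> = (1 / 2) ^ n * u powr (\<beta> * real n)"
      using u0 unfolding power_mult_distrib by (simp add: powr_powr[symmetric] powr_realpow)
    finally show "norm (\<bar>s\<bar> ^ n / Gamma (\<beta> * real n + 1)) \<le> t n u"
      using G[of n] by (simp add: t_def divide_right_mono)
  qed
qed

lemma mittag_leffler_of_real:
  assumes "0 < \<beta>"
  shows "mittag_leffler \<beta> (of_real s) = of_real (\<Sum>n. s ^ n / Gamma (\<beta> * real n + 1))"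
proof -
  have G: "Gamma (\<beta> * real n + 1) > 0" for n
    using assms by (intro Gamma_real_pos) (simp add: add_nonneg_pos)
  have "summable (\<lambda>n. s ^ n / Gamma (\<beta> * real n + 1))"
    by (rule summable_norm_cancel)
      (use summable_mittag_leffler[OF assms, of s] G in \<open>simp add: power_abs abs_of_pos\<close>)
  then show ?thesis
    unfolding mittag_leffler_def
    by (simp only: suminf_of_real of_real_divide of_real_power Gamma_complex_of_real)
qed

text \<open>If the Laplace transform of $X$ is $E_\beta(-s)$ and $U$ is an independent standard exponential
  variable, then $U^\beta X$ is standard exponential: the moments $\Gamma(\beta n + 1)$ of $U^\beta$ cancel
  the coefficients of $E_\beta$. The moment of $X$ is then a quotient of two
  exponential moments.\<close>
lemma (in prob_space) mittag_leffler_negative_moment: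
  fixes X :: "'a \<Rightarrow> real"
  assumes X[measurable]: "X \<in> borel_measurable M" and X_pos: "AE \<omega> in M. 0 < X \<omega>"
    and \<beta>: "0 < \<beta>" "\<beta> \<le> 1" and c: "0 < c" "c < 1"
    and L: "\<And>s. 0 \<le> s \<Longrightarrow> expectation (\<lambda>\<omega>. exp (- s * X \<omega>)) = (\<Sum>n. (- s) ^ n / Gamma (\<beta> * real n + 1))"
  shows "(\<integral>\<^sup>+\<omega>. ennreal (X \<omega> powr (- c)) \<partial>M) = ennreal (Gamma (1 - c) / Gamma (1 - \<beta> * c))"
proof -
  interpret E: prob_space std_exponential
    by (rule prob_space_exponential_density) simp
  interpret P: pair_prob_space std_exponential M ..
  have G: "Gamma (\<beta> * real n + 1) > 0" for n
    using \<beta> by (intro Gamma_real_pos) (simp add: add_nonneg_pos)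
  define Y where "Y p = fst p powr \<beta> * X (snd p)" for p
  have Y[measurable]: "Y \<in> borel_measurable (std_exponential \<Otimes>\<^sub>M M)"
    unfolding Y_def by measurable
  have Y_pos: "AE p in std_exponential \<Otimes>\<^sub>M M. 0 < Y p"
  proof (rule P.AE_pair_measure)
    show "{p \<in> space (std_exponential \<Otimes>\<^sub>M M). 0 < Y p} \<in> sets (std_exponential \<Otimes>\<^sub>M M)"
      by measurable
    show "AE u in std_exponential. AE \<omega> in M. 0 < Y (u, \<omega>)"
      using AE_std_exponential
    proof eventually_elim
      fix u :: real assume "0 < u"
      then show "AE \<omega> in M. 0 < Y (u, \<omega>)"
        using X_pos by (auto simp: Y_def elim!: eventually_mono)
    qed
  qed
  have Y_exp: "P.expectation (\<lambda>p. exp (- z * Y p)) = 1 / (1 + z)" if z: "0 < z" "z < 1" for z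
  proof -
    have int: "integrable (std_exponential \<Otimes>\<^sub>M M) (\<lambda>p. exp (- z * Y p))"
      using z Y_pos by (intro P.integrable_const_bound[where B = 1]) (auto elim!: eventually_mono)
    define t where "t n u = (- z) ^ n * (u powr (\<beta> * real n) / Gamma (\<beta> * real n + 1))" for n u
    have t_int: "integrable std_exponential (t n)" for n
      unfolding t_def using \<beta> by (intro integrable_mult_right integrable_divide std_exponential_power) simp
    have t_val: "(LINT u|std_exponential. \<bar>z\<bar> ^ n * (u powr (\<beta> * real n) / Gamma (\<beta> * real n + 1))) = \<bar>z\<bar> ^ n"
      "(LINT u|std_exponential. t n u) = (- z) ^ n" for n
      unfolding t_def using \<beta> G[of n] by (auto simp: std_exponential_power)
    \<comment> \<open>The summands integrate to \<open>\<bar>z\<bar> ^ n\<close> in norm, so \<open>z < 1\<close> makes termwise integration legitimate.\<close>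
    have t_norm: "norm (t n u) = \<bar>z\<bar> ^ n * (u powr (\<beta> * real n) / Gamma (\<beta> * real n + 1))" for n u
      using G[of n] by (simp add: t_def abs_mult power_abs)
    have t_eq: "t n u = (- (z * u powr \<beta>)) ^ n / Gamma (\<beta> * real n + 1)" if "0 < u" for n u
    proof -
      have "(- (z * u powr \<beta>)) ^ n = (- z) ^ n * (u powr \<beta>) ^ n"
        by (simp flip: power_mult_distrib)
      also have "(u powr \<beta>) ^ n = u powr (\<beta> * real n)"
        using that by (simp add: powr_powr[symmetric] powr_realpow)
      finally show ?thesis by (simp add: t_def)
    qed
    have "P.expectation (\<lambda>p. exp (- z * Y p)) = (LINT u|std_exponential. expectation (\<lambda>\<omega>. exp (- z * Y (u, \<omega>))))"
      using P.integral_fst'[OF int] by simp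
    also have "\<dots> = (LINT u|std_exponential. (\<Sum>n. t n u))"
    proof (rule integral_cong_AE)
      show "AE u in std_exponential. expectation (\<lambda>\<omega>. exp (- z * Y (u, \<omega>))) = (\<Sum>n. t n u)"
        using AE_std_exponential
      proof eventually_elim
        fix u :: real assume u: "0 < u"
        have "expectation (\<lambda>\<omega>. exp (- z * Y (u, \<omega>))) = expectation (\<lambda>\<omega>. exp (- (z * u powr \<beta>) * X \<omega>))"
          by (simp add: Y_def mult.assoc)
        also have "\<dots> = (\<Sum>n. t n u)"
          using z by (subst L) (auto simp: t_eq[OF u])
        finally show "expectation (\<lambda>\<omega>. exp (- z * Y (u, \<omega>))) = (\<Sum>n. t n u)" .
      qed
    qed (auto simp: t_def)
    also have "\<dots> = (\<Sum>n. LINT u|std_exponential. t n u)"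
    proof (rule integral_suminf)
      show "AE u in std_exponential. summable (\<lambda>n. norm (t n u))"
        using AE_std_exponential
      proof eventually_elim
        fix u :: real assume u: "0 < u"
        have "norm (t n u) = \<bar>z * u powr \<beta>\<bar> ^ n / Gamma (\<beta> * real n + 1)" for n
          unfolding t_eq[OF u] using G[of n] by (simp add: power_abs)
        then show "summable (\<lambda>n. norm (t n u))"
          using summable_mittag_leffler[OF \<beta>(1), of "z * u powr \<beta>"] by simp
      qed
      show "summable (\<lambda>n. LINT u|std_exponential. norm (t n u))"
        unfolding t_norm t_val using z by (simp add: summable_geometric)
    qed (rule t_int)
    also have "\<dots> = 1 / (1 + z)"
      unfolding t_val using z suminf_geometric[of "- z"] by simp
    finally show ?thesis .
  qed
  have "\<beta> * c \<le> c" using mult_right_mono[OF \<beta>(2), of c] c by simp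
  with c have \<beta>c: "\<beta> * c < 1" by linarith
  have "ennreal (Gamma (1 - c)) = (\<integral>\<^sup>+p. ennreal (Y p powr (- c)) \<partial>(std_exponential \<Otimes>\<^sub>M M))"
    by (rule P.exponential_negative_moment[symmetric]) (use Y_pos Y_exp c in auto)
  also have "\<dots> = (\<integral>\<^sup>+u. \<integral>\<^sup>+\<omega>. ennreal (Y (u, \<omega>) powr (- c)) \<partial>M \<partial>std_exponential)"
    by (rule nn_integral_fst[symmetric]) measurable
  also have "\<dots> = (\<integral>\<^sup>+u. \<integral>\<^sup>+\<omega>. ennreal (u powr (- \<beta> * c)) * ennreal (X \<omega> powr (- c)) \<partial>M \<partial>std_exponential)"
  proof (intro nn_integral_cong_AE)
    show "AE u in std_exponential. (\<integral>\<^sup>+\<omega>. ennreal (Y (u, \<omega>) powr (- c)) \<partial>M)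
       = (\<integral>\<^sup>+\<omega>. ennreal (u powr (- \<beta> * c)) * ennreal (X \<omega> powr (- c)) \<partial>M)"
      using AE_std_exponential
    proof eventually_elim
      fix u :: real assume u: "0 < u"
      show "(\<integral>\<^sup>+\<omega>. ennreal (Y (u, \<omega>) powr (- c)) \<partial>M)
         = (\<integral>\<^sup>+\<omega>. ennreal (u powr (- \<beta> * c)) * ennreal (X \<omega> powr (- c)) \<partial>M)"
        using X_pos u
        by (intro nn_integral_cong_AE)
          (auto elim!: eventually_mono simp: Y_def powr_mult powr_powr ennreal_mult')
    qed
  qed
  also have "\<dots> = (\<integral>\<^sup>+u. ennreal (u powr (- \<beta> * c)) \<partial>std_exponential) * (\<integral>\<^sup>+\<omega>. ennreal (X \<omega> powr (- c)) \<partial>M)"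
    by (simp add: nn_integral_cmult nn_integral_multc)
  also have "(\<integral>\<^sup>+u. ennreal (u powr (- \<beta> * c)) \<partial>std_exponential) = ennreal (Gamma (1 - \<beta> * c))"
    using std_exponential_moment[of "1 - \<beta> * c"] \<beta>c by simp
  finally have eq: "ennreal (Gamma (1 - c)) = ennreal (Gamma (1 - \<beta> * c)) * (\<integral>\<^sup>+\<omega>. ennreal (X \<omega> powr (- c)) \<partial>M)" .
  have G1: "Gamma (1 - \<beta> * c) > 0" using \<beta>c by (simp add: Gamma_real_pos)
  have "ennreal (1 / Gamma (1 - \<beta> * c)) * ennreal (Gamma (1 - c)) =
      ennreal (1 / Gamma (1 - \<beta> * c) * Gamma (1 - \<beta> * c)) * (\<integral>\<^sup>+\<omega>. ennreal (X \<omega> powr (- c)) \<partial>M)"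
    unfolding eq using G1 by (subst ennreal_mult') (auto simp: mult.assoc)
  then show ?thesis
    using G1 by (simp add: ennreal_mult'[symmetric])
qed

section \<open>Isotropic Gaussian densities\<close>

text \<open>The centred Gaussian density with covariance $v$ times the identity; \<open>v\<close> is the
  variance, not the standard deviation.\<close>
definition gauss :: "real \<Rightarrow> 'a::euclidean_space \<Rightarrow> real" where
  "gauss v y = (2 * pi * v) powr (- (real DIM('a) / 2)) * exp (- (norm y)\<^sup>2 / (2 * v))"

lemma gauss_nonneg [simp]: "0 \<le> gauss v y"
  by (simp add: gauss_def)

lemma borel_measurable_gauss [measurable]:
  assumes [measurable]: "f \<in> borel_measurable N" "g \<in> borel_measurable N"
  shows "(\<lambda>x. gauss (f x) (g x)) \<in> borel_measurable N"
  unfolding gauss_def by measurable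

lemma gauss_eq_prod_normal_density:
  fixes y :: "'a::euclidean_space"
  assumes v: "0 < v"
  shows "gauss v y = (\<Prod>b\<in>Basis. normal_density 0 (sqrt v) (y \<bullet> b))"
proof -
  have "(norm y)\<^sup>2 = (\<Sum>b\<in>Basis. (y \<bullet> b)\<^sup>2)"
    unfolding power2_norm_eq_inner by (subst euclidean_inner) (simp add: power2_eq_square)
  then have e: "exp (- (norm y)\<^sup>2 / (2 * v)) = (\<Prod>b\<in>Basis. exp (- (y \<bullet> b)\<^sup>2 / (2 * v)))"
    by (simp add: exp_sum[symmetric] sum_negf sum_divide_distrib)
  have "(2 * pi * v) powr (- (real DIM('a) / 2)) = ((2 * pi * v) powr (- 1 / 2)) powr real DIM('a)"
    by (simp add: powr_powr)
  also have "(2 * pi * v) powr (- 1 / 2) = 1 / sqrt (2 * pi * v)"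
    using v by (simp add: powr_minus_divide powr_half_sqrt)
  finally have p: "(2 * pi * v) powr (- (real DIM('a) / 2)) = (1 / sqrt (2 * pi * v)) ^ DIM('a)"
    using v by (simp add: powr_realpow)
  show ?thesis
    using v unfolding gauss_def e p normal_density_def prod.distrib by simp
qed

lemma integral_cos_std_normal:
  "integrable lborel (\<lambda>x. cos (t * x) * std_normal_density x)"
  "(LBINT x. cos (t * x) * std_normal_density x) = exp (- t\<^sup>2 / 2)"
proof -
  interpret N: prob_space std_normal_distribution
    by (rule prob_space_normal_density) simp
  have int: "integrable std_normal_distribution (\<lambda>x. iexp (t * x))"
    by (rule N.integrable_const_bound[where B = 1]) auto
  have "(LINT x|std_normal_distribution. cos (t * x)) = Re (char std_normal_distribution t)"
    unfolding char_def by (subst integral_Re[OF int, symmetric]) (simp add: Re_exp)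
  also have "\<dots> = exp (- t\<^sup>2 / 2)"
    unfolding char_std_normal_distribution by simp
  finally show "(LBINT x. cos (t * x) * std_normal_density x) = exp (- t\<^sup>2 / 2)"
    by (subst (asm) integral_density) (auto simp: mult.commute)
  have "integrable std_normal_distribution (\<lambda>x. cos (t * x))"
    by (rule N.integrable_const_bound[where B = 1]) auto
  then show "integrable lborel (\<lambda>x. cos (t * x) * std_normal_density x)"
    by (subst (asm) integrable_density) (auto simp: mult.commute)
qed

text \<open>The real part of the characteristic function, shifted by 1: the integrand is then nonnegative,
  so that the results on nonnegative integrals (product formula on the Euclidean space, Tonelli)
  apply without any integrability side conditions.\<close>
lemma nn_integral_cos_normal:
  assumes s: "0 < \<sigma>"
  shows "(\<integral>\<^sup>+x. ennreal ((1 + cos (c * x)) * normal_density 0 \<sigma> x) \<partial>lborel) = ennreal (1 + exp (- (c * \<sigma>)\<^sup>2 / 2))"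
proof -
  have n: "0 \<le> 1 + cos z" for z :: real
    using cos_ge_minus_one[of z] by linarith
  have nd: "normal_density 0 \<sigma> (0 + \<sigma> * x) = std_normal_density x / \<sigma>" for x
    using s by (simp add: normal_density_def real_sqrt_mult power_mult_distrib field_simps)
  have "(\<integral>\<^sup>+x. ennreal ((1 + cos (c * x)) * normal_density 0 \<sigma> x) \<partial>lborel)
     = \<bar>\<sigma>\<bar> * (\<integral>\<^sup>+x. ennreal ((1 + cos (c * (0 + \<sigma> * x))) * normal_density 0 \<sigma> (0 + \<sigma> * x)) \<partial>lborel)"
    using s by (intro nn_integral_real_affine) auto
  also have "\<dots> = (\<integral>\<^sup>+x. ennreal (std_normal_density x + cos (c * \<sigma> * x) * std_normal_density x) \<partial>lborel)"
  proof (subst nn_integral_cmult[symmetric])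
    have "\<sigma> * ((1 + cos z) * (w / \<sigma>)) = w + cos z * w" for z w
      using s by (simp add: field_simps)
    then show "(\<integral>\<^sup>+x. ennreal \<bar>\<sigma>\<bar> * ennreal ((1 + cos (c * (0 + \<sigma> * x))) * normal_density 0 \<sigma> (0 + \<sigma> * x)) \<partial>lborel)
       = (\<integral>\<^sup>+x. ennreal (std_normal_density x + cos (c * \<sigma> * x) * std_normal_density x) \<partial>lborel)"
      unfolding nd using s by (simp add: ennreal_mult'[symmetric] mult.assoc)
  qed simp
  also have "\<dots> = ennreal (LBINT x. std_normal_density x + cos (c * \<sigma> * x) * std_normal_density x)"
  proof (rule nn_integral_eq_integral)
    have "0 \<le> (1 + cos (c * \<sigma> * x)) * std_normal_density x" for x
      by (intro mult_nonneg_nonneg n) simp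
    then show "AE x in lborel. 0 \<le> std_normal_density x + cos (c * \<sigma> * x) * std_normal_density x"
      by (simp add: algebra_simps)
  qed (intro Bochner_Integration.integrable_add integral_cos_std_normal integrable_normal_density, simp)
  also have "(LBINT x. std_normal_density x + cos (c * \<sigma> * x) * std_normal_density x) = 1 + exp (- (c * \<sigma>)\<^sup>2 / 2)"
    using integral_cos_std_normal[of "c * \<sigma>"]
    by (subst Bochner_Integration.integral_add) (auto simp: integral_normal_density)
  finally show ?thesis .
qed

lemma nn_integral_cos_gauss:
  fixes e :: "'a::euclidean_space"
  assumes v: "0 < v" and e: "e \<in> Basis"
  shows "(\<integral>\<^sup>+y. ennreal ((1 + cos (c * (y \<bullet> e))) * gauss v y) \<partial>lborel) = ennreal (1 + exp (- (c\<^sup>2 * v / 2)))"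
proof -
  have n: "0 \<le> 1 + cos z" for z :: real
    using cos_ge_minus_one[of z] by linarith
  \<comment> \<open>Only the factor in direction \<open>e\<close> carries the cosine; the others integrate to 1.\<close>
  define f where "f b x = (if b = e then 1 + cos (c * x) else 1) * normal_density 0 (sqrt v) x" for b :: 'a and x
  have "(1 + cos (c * (y \<bullet> e))) * gauss v y = (\<Prod>b\<in>Basis. f b (y \<bullet> b))" for y
    unfolding f_def prod.distrib gauss_eq_prod_normal_density[OF v]
    using e by (simp add: prod.delta)
  then have "(\<integral>\<^sup>+y. ennreal ((1 + cos (c * (y \<bullet> e))) * gauss v y) \<partial>lborel)
     = (\<integral>\<^sup>+y. (\<Prod>b\<in>Basis. ennreal (f b (y \<bullet> b))) \<partial>lborel)"
    by (simp add: prod_ennreal f_def n)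
  also have "\<dots> = (\<Prod>b\<in>Basis. \<integral>\<^sup>+x. ennreal (f b x) \<partial>lborel)"
    by (rule nn_integral_lborel_prod) (auto simp: f_def n)
  also have "\<dots> = (\<Prod>b\<in>Basis. if b = e then ennreal (1 + exp (- (c\<^sup>2 * v / 2))) else 1)"
  proof (rule prod.cong[OF refl])
    fix b :: 'a
    have "(\<integral>\<^sup>+x. ennreal (normal_density 0 (sqrt v) x) \<partial>lborel) = 1"
      using v by (subst nn_integral_eq_integral) (auto simp: integral_normal_density integrable_normal_density)
    then show "(\<integral>\<^sup>+x. ennreal (f b x) \<partial>lborel) = (if b = e then ennreal (1 + exp (- (c\<^sup>2 * v / 2))) else 1)"
      using nn_integral_cos_normal[of "sqrt v" c] v by (simp add: f_def power_mult_distrib)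
  qed
  finally show ?thesis
    using e by (simp add: prod.delta)
qed

text \<open>Substitute $s = K t^{-\alpha}$ in the Gamma integral.\<close>
lemma Gamma_nn_integral_inverse_power:
  fixes K a \<alpha> :: real
  assumes K: "0 < K" and a: "0 < a" and \<alpha>: "0 < \<alpha>"
  shows "(\<integral>\<^sup>+t. ennreal (indicator {0<..} t * (t powr (- \<alpha> * a - 1) * exp (- K * t powr (- \<alpha>)))) \<partial>lborel)
     = ennreal (Gamma a / (\<alpha> * K powr a))"
proof -
  define f where "f s = s powr (a - 1) / exp s" for s :: real
  define g where "g t = K * t powr (- \<alpha>)" for t
  define g' where "g' t = - \<alpha> * K * t powr (- \<alpha> - 1)" for t
  have "(f has_integral Gamma a) {0<..}"
    unfolding f_def
    by (subst has_integral_spike_set_eq[of _ "{0..}"])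
      (use Gamma_integral_real[OF a] in \<open>auto intro: negligible_subset[of "{0}"]\<close>)
  moreover have img: "g ` {0<..} = {0<..}"
  proof safe
    fix s :: real assume s: "0 < s"
    have "g ((s / K) powr (- 1 / \<alpha>)) = s"
      using s K \<alpha> by (simp add: g_def powr_powr)
    then show "s \<in> g ` {0<..}"
      using s K by (intro image_eqI[of _ _ "(s / K) powr (- 1 / \<alpha>)"]) auto
  qed (use K in \<open>auto simp: g_def\<close>)
  ultimately have f: "f absolutely_integrable_on g ` {0<..} \<and> integral (g ` {0<..}) f = Gamma a"
    by (auto intro!: nonnegative_absolutely_integrable_1 simp: f_def integral_unique has_integral_integrable)
  have inj: "inj_on g {0<..}"
  proof (rule inj_onI)
    fix s t :: real assume st: "s \<in> {0<..}" "t \<in> {0<..}" "g s = g t"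
    then have "s powr (- \<alpha>) = t powr (- \<alpha>)" using K by (simp add: g_def)
    then have "(s powr (- \<alpha>)) powr (- 1 / \<alpha>) = (t powr (- \<alpha>)) powr (- 1 / \<alpha>)" by simp
    then show "s = t" using st \<alpha> by (simp add: powr_powr)
  qed
  have der: "(g has_field_derivative g' t) (at t within {0<..})" if "t \<in> {0<..}" for t
    unfolding g_def g'_def using that
    by (auto intro!: derivative_eq_intros simp: powr_diff field_simps powr_minus)
  have "(\<lambda>t. \<bar>g' t\<bar> * f (g t)) absolutely_integrable_on {0<..} \<and> integral {0<..} (\<lambda>t. \<bar>g' t\<bar> * f (g t)) = Gamma a"
    by (subst has_absolute_integral_change_of_variables_1'[OF _ der inj]) (use f in auto)
  then have "((\<lambda>t. \<bar>g' t\<bar> * f (g t)) has_integral Gamma a) {0<..}"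
    using absolutely_integrable_on_def has_integral_integral by metis
  then have I: "(\<integral>\<^sup>+t. ennreal (indicator {0<..} t * (\<bar>g' t\<bar> * f (g t))) \<partial>lborel) = ennreal (Gamma a)"
    by (intro nn_integral_has_integral_lebesgue) (auto simp: f_def)
  have C: "0 < \<alpha> * K powr a" using K \<alpha> by simp
  have "(\<integral>\<^sup>+t. ennreal (indicator {0<..} t * (t powr (- \<alpha> * a - 1) * exp (- K * t powr (- \<alpha>)))) \<partial>lborel)
     = (\<integral>\<^sup>+t. ennreal (1 / (\<alpha> * K powr a)) * ennreal (indicator {0<..} t * (\<bar>g' t\<bar> * f (g t))) \<partial>lborel)"
  proof (intro nn_integral_cong)
    fix t :: real
    have "t powr (- \<alpha> * a - 1) * exp (- K * t powr (- \<alpha>)) = 1 / (\<alpha> * K powr a) * (\<bar>g' t\<bar> * f (g t))" if "0 < t"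
    proof -
      have "K powr (a - 1) * K = K powr a"
        using K by (simp add: powr_diff)
      moreover have "t powr (- \<alpha> - 1) * t powr (- \<alpha> * (a - 1)) = t powr (- \<alpha> * a - 1)"
        unfolding powr_add[symmetric] by (rule arg_cong[where f = "(powr) t"]) (simp add: algebra_simps)
      ultimately have "\<bar>g' t\<bar> * f (g t) = \<alpha> * K powr a * (t powr (- \<alpha> * a - 1) * exp (- K * t powr (- \<alpha>)))"
        using that K \<alpha> unfolding g'_def f_def g_def
        by (simp add: abs_mult powr_mult powr_powr exp_minus field_simps)
      then show ?thesis using K \<alpha> by simp
    qed
    then show "ennreal (indicator {0<..} t * (t powr (- \<alpha> * a - 1) * exp (- K * t powr (- \<alpha>))))
       = ennreal (1 / (\<alpha> * K powr a)) * ennreal (indicator {0<..} t * (\<bar>g' t\<bar> * f (g t)))"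
      using C by (auto simp: indicator_def ennreal_mult'[symmetric])
  qed
  also have "\<dots> = ennreal (1 / (\<alpha> * K powr a)) * ennreal (Gamma a)"
  proof (subst nn_integral_cmult)
    show "(\<lambda>t. ennreal (indicator {0<..} t * (\<bar>g' t\<bar> * f (g t)))) \<in> borel_measurable lborel"
      unfolding f_def g_def g'_def by measurable
  qed (simp only: I)
  finally show ?thesis
    using C by (simp add: ennreal_mult'[symmetric])
qed

text \<open>With $K = |y|^2/(2\tau)$ and $a = d/2 - 1/\alpha$ the integrand is a constant times
  $t^{-\alpha a - 1} e^{-K t^{-\alpha}}$; positivity of $a$ is the transience condition $d\alpha > 2$.\<close>
lemma gauss_time_integral:
  fixes y :: "'a::euclidean_space"
  assumes y: "y \<noteq> 0" and \<tau>: "0 < \<tau>" and \<alpha>: "0 < \<alpha>" "2 < real DIM('a) * \<alpha>"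
  shows "(\<integral>\<^sup>+t. ennreal (indicator {0<..} t * gauss (t powr \<alpha> * \<tau>) y) \<partial>lborel)
    = ennreal (1 / \<alpha> * 2 powr (- (1 / \<alpha>)) * pi powr (- (real DIM('a) / 2)) * Gamma (real DIM('a) / 2 - 1 / \<alpha>)
        * (1 / norm y powr (real DIM('a) - 2 / \<alpha>)) * \<tau> powr (- (1 / \<alpha>)))"
proof -
  define d where "d = real DIM('a)"
  define a where "a = d / 2 - 1 / \<alpha>"
  define K where "K = (norm y)\<^sup>2 / (2 * \<tau>)"
  have a: "0 < a" using \<alpha> by (simp add: a_def d_def field_simps)
  have K: "0 < K" using y \<tau> by (simp add: K_def)
  have "(\<integral>\<^sup>+t. ennreal (indicator {0<..} t * gauss (t powr \<alpha> * \<tau>) y) \<partial>lborel)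
     = (\<integral>\<^sup>+t. ennreal ((2 * pi * \<tau>) powr (- d / 2)) * ennreal (indicator {0<..} t * (t powr (- \<alpha> * a - 1) * exp (- K * t powr (- \<alpha>)))) \<partial>lborel)"
  proof (intro nn_integral_cong)
    fix t :: real
    have "gauss (t powr \<alpha> * \<tau>) y = (2 * pi * \<tau>) powr (- d / 2) * (t powr (- \<alpha> * a - 1) * exp (- K * t powr (- \<alpha>)))" if t: "0 < t"
    proof -
      have "(2 * pi * (t powr \<alpha> * \<tau>)) powr (- d / 2) = ((2 * pi * \<tau>) * t powr \<alpha>) powr (- d / 2)"
        by (simp add: mult_ac)
      also have "\<dots> = (2 * pi * \<tau>) powr (- d / 2) * t powr (- \<alpha> * a - 1)"
        using \<tau> \<alpha> by (subst powr_mult) (auto simp: powr_powr a_def algebra_simps)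
      finally show ?thesis
        using t \<tau> by (simp add: gauss_def d_def K_def powr_minus field_simps)
    qed
    then show "ennreal (indicator {0<..} t * gauss (t powr \<alpha> * \<tau>) y) = ennreal ((2 * pi * \<tau>) powr (- d / 2)) * ennreal (indicator {0<..} t * (t powr (- \<alpha> * a - 1) * exp (- K * t powr (- \<alpha>))))"
      by (auto simp: indicator_def ennreal_mult'[symmetric])
  qed
  also have "\<dots> = ennreal ((2 * pi * \<tau>) powr (- d / 2)) * ennreal (Gamma a / (\<alpha> * K powr a))"
    by (subst nn_integral_cmult) (auto simp: Gamma_nn_integral_inverse_power[OF K a \<alpha>(1), simplified])
  also have "\<dots> = ennreal ((2 * pi * \<tau>) powr (- d / 2) * (Gamma a / (\<alpha> * K powr a)))"
    by (simp add: ennreal_mult'[symmetric])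
  also have "(2 * pi * \<tau>) powr (- d / 2) * (Gamma a / (\<alpha> * K powr a))
    = 1 / \<alpha> * 2 powr (- (1 / \<alpha>)) * pi powr (- (d / 2)) * Gamma a * (1 / norm y powr (d - 2 / \<alpha>)) * \<tau> powr (- (1 / \<alpha>))"
  proof -
    have "K powr a = norm y powr (d - 2 / \<alpha>) / (2 powr a * \<tau> powr a)"
      using y \<tau> by (simp add: K_def powr_divide powr_mult powr_numeral[symmetric] powr_powr a_def algebra_simps
          del: powr_numeral)
    moreover have "2 powr a = 2 powr (d / 2) * 2 powr (- (1 / \<alpha>))" "\<tau> powr a = \<tau> powr (d / 2) * \<tau> powr (- (1 / \<alpha>))"
      by (simp_all add: a_def powr_add[symmetric])
    moreover have "(2 * pi * \<tau>) powr (- d / 2) = 1 / (2 powr (d / 2)) * pi powr (- (d / 2)) * (1 / (\<tau> powr (d / 2)))"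
      using \<tau> by (simp add: powr_mult powr_minus_divide)
    ultimately show ?thesis
      using \<tau> by simp
  qed
  finally show ?thesis
    by (simp only: d_def a_def)
qed

section \<open>The mixing measure of a generalized grey Brownian motion\<close>

lemma sets_M_Wright_measure [measurable_cong, simp]: "sets (M_Wright_measure \<beta>) = sets borel"
  by (simp add: M_Wright_measure_def)

lemma space_M_Wright_measure [simp]: "space (M_Wright_measure \<beta>) = UNIV"
  by (simp add: M_Wright_measure_def)

lemma borel_measurable_M_Wright [measurable]: "M_Wright \<beta> \<in> borel_measurable borel"
  unfolding M_Wright_def[abs_def] by measurable

text \<open>Needed for Tonelli before the total mass of the measure is known.\<close>
lemma sigma_finite_M_Wright_measure: "sigma_finite_measure (M_Wright_measure \<beta>)"
proof (cases "\<beta> = 1")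
  case True
  interpret prob_space "return borel (1::real)" by (rule prob_space_return) simp
  show ?thesis using True sigma_finite_measure_axioms by (simp add: M_Wright_measure_def)
next
  case False
  have "sigma_finite_measure (density lborel (\<lambda>\<tau>. indicator {0..} \<tau> * ennreal (M_Wright \<beta> \<tau>)))"
    by (subst sigma_finite_measure.sigma_finite_iff_density_finite[OF sigma_finite_lborel]) (auto simp: ennreal_mult_eq_top_iff indicator_def)
  with False show ?thesis by (simp add: M_Wright_measure_def)
qed

lemma AE_M_Wright_measure_pos: "AE \<tau> in M_Wright_measure \<beta>. 0 < \<tau>"
proof (cases "\<beta> = 1")
  case True
  have "AE \<tau> in return borel (1 :: real). 0 < \<tau>"
    by (subst AE_return) auto
  moreover have "M_Wright_measure \<beta> = return borel 1"
    using True by (simp add: M_Wright_measure_def)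
  ultimately show ?thesis by (simp only:)
next
  case False
  have "AE \<tau> in density lborel (\<lambda>\<tau>. indicator {0..} \<tau> * ennreal (M_Wright \<beta> \<tau>)). 0 < \<tau>"
    using AE_lborel_singleton[of 0]
    by (subst AE_density) (auto elim!: eventually_mono simp: indicator_def)
  moreover have "M_Wright_measure \<beta> = density lborel (\<lambda>\<tau>. indicator {0..} \<tau> * ennreal (M_Wright \<beta> \<tau>))"
    using False by (simp add: M_Wright_measure_def)
  ultimately show ?thesis by (simp only:)
qed

lemma ggBm_cov_one: "ggBm_cov \<alpha> 1 (\<lambda>_. t) = mat 1 1 (\<lambda>_. t powr \<alpha>)"
  by (rule eq_matI) (auto simp: ggBm_cov_def)

lemma coord_quad_form_one: "coord_quad_form 1 (mat 1 1 (\<lambda>_. a)) \<theta> = a * (norm (\<theta> 0))\<^sup>2"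
  by (simp add: coord_quad_form_def scalar_prod_def norm_vec_def L2_set_def sum_nonneg sum_distrib_left
      power2_eq_square mult_ac Let_def)

lemma ggBm_density_one:
  fixes \<theta> :: "nat \<Rightarrow> real ^ 'd"
  assumes t: "0 < t"
  shows "ggBm_density \<beta> 1 (mat 1 1 (\<lambda>_. t powr \<alpha>)) (mat 1 1 (\<lambda>_. t powr (- \<alpha>))) \<theta>
    = (\<integral>\<^sup>+\<tau>. ennreal (gauss (t powr \<alpha> * \<tau>) (\<theta> 0)) \<partial>M_Wright_measure \<beta>)"
proof -
  define d where "d = real CARD('d)"
  have det: "Determinant.det (mat 1 1 (\<lambda>_. t powr \<alpha>)) = t powr \<alpha>"
    by (subst det_single) auto
  have "ggBm_density \<beta> 1 (mat 1 1 (\<lambda>_. t powr \<alpha>)) (mat 1 1 (\<lambda>_. t powr (- \<alpha>))) \<theta>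
    = (\<integral>\<^sup>+\<tau>. ennreal ((2 * pi) powr (- (d / 2)) / (t powr \<alpha>) powr (d / 2)) *
        ennreal (\<tau> powr (- (d / 2)) * exp (- (1 / (2 * \<tau>)) * (t powr (- \<alpha>) * (norm (\<theta> 0))\<^sup>2))) \<partial>M_Wright_measure \<beta>)"
    unfolding ggBm_density_def det coord_quad_form_one by (subst nn_integral_cmult) (auto simp: d_def)
  also have "\<dots> = (\<integral>\<^sup>+\<tau>. ennreal (gauss (t powr \<alpha> * \<tau>) (\<theta> 0)) \<partial>M_Wright_measure \<beta>)"
  proof (rule nn_integral_cong_AE, use AE_M_Wright_measure_pos in eventually_elim)
    fix \<tau> :: real assume \<tau>: "0 < \<tau>"
    have "(2 * pi * (t powr \<alpha> * \<tau>)) powr (- (d / 2)) = (2 * pi) powr (- (d / 2)) / (t powr \<alpha>) powr (d / 2) * \<tau> powr (- (d / 2))"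
      using \<tau> by (simp add: powr_mult powr_minus_divide)
    moreover have "- (1 / (2 * \<tau>)) * (t powr (- \<alpha>) * (norm (\<theta> 0))\<^sup>2) = - (norm (\<theta> 0))\<^sup>2 / (2 * (t powr \<alpha> * \<tau>))"
      by (simp add: powr_minus field_simps)
    ultimately show "ennreal ((2 * pi) powr (- (d / 2)) / (t powr \<alpha>) powr (d / 2)) *
        ennreal (\<tau> powr (- (d / 2)) * exp (- (1 / (2 * \<tau>)) * (t powr (- \<alpha>) * (norm (\<theta> 0))\<^sup>2)))
       = ennreal (gauss (t powr \<alpha> * \<tau>) (\<theta> 0))"
      by (simp add: gauss_def d_def ennreal_mult'[symmetric] mult.assoc)
  qed
  finally show ?thesis .
qed

text \<open>The joint density condition for a single time point, whose covariance matrix is the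
  $1 \times 1$ matrix $t^\alpha$.\<close>
lemma ggBm_one_time_law:
  fixes B :: "real \<Rightarrow> 'w \<Rightarrow> real ^ 'd" and g :: "real ^ 'd \<Rightarrow> ennreal"
  assumes B: "ggBm M \<beta> \<alpha> B" and t: "0 < t" and g[measurable]: "g \<in> borel_measurable borel"
  shows "(\<integral>\<^sup>+\<omega>. g (B t \<omega>) \<partial>M)
    = (\<integral>\<^sup>+y. g y * (\<integral>\<^sup>+\<tau>. ennreal (gauss (t powr \<alpha> * \<tau>) y) \<partial>M_Wright_measure \<beta>) \<partial>lborel)"
proof -
  interpret \<mu>: sigma_finite_measure "M_Wright_measure \<beta>" by (rule sigma_finite_M_Wright_measure)
  interpret P: product_sigma_finite "\<lambda>_ :: nat. lborel :: (real ^ 'd) measure" ..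
  let ?G = "mat 1 1 (\<lambda>_. t powr \<alpha>) :: real mat" and ?H = "mat 1 1 (\<lambda>_. t powr (- \<alpha>)) :: real mat"
  have inv: "inverts_mat ?G ?H \<and> inverts_mat ?H ?G"
    using t by (auto simp: inverts_mat_def scalar_prod_def powr_add[symmetric] intro!: eq_matI)
  have I: "{..<1::nat} = {0}" by auto
  have mono: "strict_mono_on {..<1::nat} (\<lambda>_. t)" by (auto simp: strict_mono_on_def)
  have H: "?H \<in> carrier_mat 1 1" by simp
  have "distributed M (\<Pi>\<^sub>M k\<in>{..<1::nat}. lborel) (\<lambda>\<omega>. \<lambda>k\<in>{..<1}. B t \<omega>) (ggBm_density \<beta> 1 ?G ?H)"
    using B[unfolded ggBm_def] t mono inv H unfolding ggBm_cov_one[symmetric]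
    by (auto dest!: spec[of _ "1::nat"] spec[of _ "\<lambda>_::nat. t"])
  then have D: "distributed M (\<Pi>\<^sub>M k\<in>{0::nat}. lborel) (\<lambda>\<omega>. \<lambda>k\<in>{0}. B t \<omega>)
      (\<lambda>h. \<integral>\<^sup>+\<tau>. ennreal (gauss (t powr \<alpha> * \<tau>) (h 0)) \<partial>M_Wright_measure \<beta>)"
    unfolding I ggBm_density_one[OF t, abs_def] .
  have "(\<integral>\<^sup>+\<omega>. g (B t \<omega>) \<partial>M) = (\<integral>\<^sup>+\<omega>. g ((\<lambda>k\<in>{0::nat}. B t \<omega>) 0) \<partial>M)"
    by simp
  also have "\<dots> = (\<integral>\<^sup>+h. (\<integral>\<^sup>+\<tau>. ennreal (gauss (t powr \<alpha> * \<tau>) (h 0)) \<partial>M_Wright_measure \<beta>) * g (h 0)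
      \<partial>(\<Pi>\<^sub>M k\<in>{0::nat}. lborel))"
    by (rule distributed_nn_integral[OF D, symmetric]) simp
  also have "\<dots> = (\<integral>\<^sup>+y. (\<integral>\<^sup>+\<tau>. ennreal (gauss (t powr \<alpha> * \<tau>) y) \<partial>M_Wright_measure \<beta>) * g y \<partial>lborel)"
    by (rule P.product_nn_integral_singleton) measurable
  finally show ?thesis by (simp add: mult.commute)
qed

text \<open>Both the total mass ($c = 0$) and the Laplace transform of the mixing measure are contained in
  this identity.\<close>
lemma ggBm_cos_expectation:
  fixes B :: "real \<Rightarrow> 'w \<Rightarrow> real ^ 'd"
  assumes B: "ggBm M \<beta> \<alpha> B" and e: "e \<in> Basis"
  shows "(\<integral>\<^sup>+\<omega>. ennreal (1 + cos (c * (B 1 \<omega> \<bullet> e))) \<partial>M)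
     = (\<integral>\<^sup>+\<tau>. ennreal (1 + exp (- (c\<^sup>2 * \<tau> / 2))) \<partial>M_Wright_measure \<beta>)"
proof -
  interpret \<mu>: sigma_finite_measure "M_Wright_measure \<beta>" by (rule sigma_finite_M_Wright_measure)
  interpret P: pair_sigma_finite "M_Wright_measure \<beta>" "lborel :: (real ^ 'd) measure" ..
  have n: "0 \<le> 1 + cos z" for z :: real
    using cos_ge_minus_one[of z] by linarith
  have "(\<integral>\<^sup>+\<omega>. ennreal (1 + cos (c * (B 1 \<omega> \<bullet> e))) \<partial>M)
     = (\<integral>\<^sup>+y. ennreal (1 + cos (c * (y \<bullet> e))) * (\<integral>\<^sup>+\<tau>. ennreal (gauss (1 powr \<alpha> * \<tau>) y) \<partial>M_Wright_measure \<beta>) \<partial>lborel)"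
    by (rule ggBm_one_time_law[OF B]) auto
  also have "\<dots> = (\<integral>\<^sup>+y. \<integral>\<^sup>+\<tau>. ennreal ((1 + cos (c * (y \<bullet> e))) * gauss \<tau> y) \<partial>M_Wright_measure \<beta> \<partial>lborel)"
    using n by (subst nn_integral_cmult[symmetric]) (auto simp: ennreal_mult')
  also have "\<dots> = (\<integral>\<^sup>+\<tau>. \<integral>\<^sup>+y. ennreal ((1 + cos (c * (y \<bullet> e))) * gauss \<tau> y) \<partial>lborel \<partial>M_Wright_measure \<beta>)"
    by (rule P.Fubini') measurable
  also have "\<dots> = (\<integral>\<^sup>+\<tau>. ennreal (1 + exp (- (c\<^sup>2 * \<tau> / 2))) \<partial>M_Wright_measure \<beta>)"
    by (rule nn_integral_cong_AE, use AE_M_Wright_measure_pos in eventually_elim)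
      (rule nn_integral_cos_gauss[OF _ e])
  finally show ?thesis .
qed

lemma ggBm_prob_space_M_Wright:
  fixes B :: "real \<Rightarrow> 'w \<Rightarrow> real ^ 'd"
  assumes B: "ggBm M \<beta> \<alpha> B"
  shows "prob_space (M_Wright_measure \<beta>)"
proof
  interpret prob_space M using B by (simp add: ggBm_def)
  obtain e :: "real ^ 'd" where e: "e \<in> Basis" by (meson SOME_Basis)
  have "2 * emeasure (M_Wright_measure \<beta>) UNIV = 2 * 1"
    using ggBm_cos_expectation[OF B e, of 0] by (simp add: emeasure_space_1)
  then show "emeasure (M_Wright_measure \<beta>) (space (M_Wright_measure \<beta>)) = 1"
    unfolding ennreal_mult_cancel_left by simp
qed

text \<open>The right-hand side is the characteristic function of $B(1)$ at a vector $\theta$ with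
  $\frac12|\theta|^2 = s$, the left-hand side the same quantity computed from the mixture density.\<close>
lemma ggBm_laplace_M_Wright:
  fixes B :: "real \<Rightarrow> 'w \<Rightarrow> real ^ 'd"
  assumes B: "ggBm M \<beta> \<alpha> B" and s: "0 \<le> s"
  shows "(LINT \<tau>|M_Wright_measure \<beta>. exp (- s * \<tau>)) = (\<Sum>n. (- s) ^ n / Gamma (\<beta> * real n + 1))"
proof -
  interpret prob_space M using B by (simp add: ggBm_def)
  interpret \<mu>: prob_space "M_Wright_measure \<beta>" by (rule ggBm_prob_space_M_Wright[OF B])
  have \<beta>: "0 < \<beta>" and B1[measurable]: "B 1 \<in> borel_measurable M" using B by (simp_all add: ggBm_def)
  obtain e :: "real ^ 'd" where e: "e \<in> Basis" by (meson SOME_Basis)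
  \<comment> \<open>The evaluation point \<open>\<theta> = c *\<^sub>R e\<close> has \<open>(norm \<theta>)\<^sup>2 / 2 = s\<close>.\<close>
  define c where "c = sqrt (2 * s)"
  have c: "c\<^sup>2 = 2 * s" using s by (simp add: c_def)
  have n: "0 \<le> 1 + cos z" for z :: real
    using cos_ge_minus_one[of z] by linarith
  have int: "integrable M (\<lambda>\<omega>. cos (c * (B 1 \<omega> \<bullet> e)))"
    by (rule integrable_const_bound[where B = 1]) auto
  have int2: "integrable (M_Wright_measure \<beta>) (\<lambda>\<tau>. exp (- s * \<tau>))"
    using AE_M_Wright_measure_pos[of \<beta>] s
    by (intro \<mu>.integrable_const_bound[where B = 1]) (auto elim!: eventually_mono)
  have "ennreal (expectation (\<lambda>\<omega>. 1 + cos (c * (B 1 \<omega> \<bullet> e)))) = (\<integral>\<^sup>+\<omega>. ennreal (1 + cos (c * (B 1 \<omega> \<bullet> e))) \<partial>M)"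
    using int n by (subst nn_integral_eq_integral) auto
  also have "\<dots> = (\<integral>\<^sup>+\<tau>. ennreal (1 + exp (- s * \<tau>)) \<partial>M_Wright_measure \<beta>)"
    unfolding ggBm_cos_expectation[OF B e] c by simp
  also have "\<dots> = ennreal (LINT \<tau>|M_Wright_measure \<beta>. 1 + exp (- s * \<tau>))"
    using int2 by (subst nn_integral_eq_integral) auto
  finally have "expectation (\<lambda>\<omega>. 1 + cos (c * (B 1 \<omega> \<bullet> e))) = (LINT \<tau>|M_Wright_measure \<beta>. 1 + exp (- s * \<tau>))"
    using n by (subst (asm) ennreal_inj) (auto intro!: Bochner_Integration.integral_nonneg add_nonneg_nonneg)
  then have L: "(LINT \<tau>|M_Wright_measure \<beta>. exp (- s * \<tau>)) = expectation (\<lambda>\<omega>. cos (c * (B 1 \<omega> \<bullet> e)))"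
    using int int2 by (simp add: prob_space \<mu>.prob_space[simplified])
  have mono: "strict_mono_on {..<1::nat} (\<lambda>_. 1::real)" by (auto simp: strict_mono_on_def)
  have "(LINT \<omega>|M. exp (\<i> * of_real (\<Sum>k<1. inner (\<theta> k) (B 1 \<omega>))))
      = mittag_leffler \<beta> (of_real (- (1 / 2) * coord_quad_form 1 (ggBm_cov \<alpha> 1 (\<lambda>_. 1)) \<theta>))" for \<theta> :: "nat \<Rightarrow> real ^ 'd"
    using B[unfolded ggBm_def] mono
    by (auto dest!: spec[of _ "1::nat"] spec[of _ "\<lambda>_::nat. 1::real"])
  then have "(LINT \<omega>|M. exp (\<i> * of_real (\<Sum>k<(1::nat). inner (c *\<^sub>R e) (B 1 \<omega>))))
      = mittag_leffler \<beta> (of_real (- (1 / 2) * coord_quad_form 1 (ggBm_cov \<alpha> 1 (\<lambda>_. 1)) (\<lambda>_. c *\<^sub>R e)))" .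
  also have "coord_quad_form 1 (ggBm_cov \<alpha> 1 (\<lambda>_. 1)) (\<lambda>_. c *\<^sub>R e) = 2 * s"
    unfolding ggBm_cov_one coord_quad_form_one using e c by (simp add: power_mult_distrib)
  also have "mittag_leffler \<beta> (of_real (- (1 / 2) * (2 * s))) = of_real (\<Sum>n. (- s) ^ n / Gamma (\<beta> * real n + 1))"
    by (subst mittag_leffler_of_real[OF \<beta>]) simp
  finally have E: "(LINT \<omega>|M. exp (\<i> * of_real (c * (B 1 \<omega> \<bullet> e)))) = of_real (\<Sum>n. (- s) ^ n / Gamma (\<beta> * real n + 1))"
    by (simp add: inner_commute)
  have int3: "integrable M (\<lambda>\<omega>. exp (\<i> * of_real (c * (B 1 \<omega> \<bullet> e))))"
    by (rule integrable_const_bound[where B = 1]) auto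
  have "expectation (\<lambda>\<omega>. cos (c * (B 1 \<omega> \<bullet> e))) = Re (LINT \<omega>|M. exp (\<i> * of_real (c * (B 1 \<omega> \<bullet> e))))"
    by (subst integral_Re[OF int3, symmetric]) (simp add: Re_exp)
  then show ?thesis
    unfolding L E by simp
qed

lemma ggBm_M_Wright_moment:
  fixes B :: "real \<Rightarrow> 'w \<Rightarrow> real ^ 'd"
  assumes B: "ggBm M \<beta> \<alpha> B" and \<alpha>: "1 < \<alpha>"
  shows "(\<integral>\<^sup>+\<tau>. ennreal (\<tau> powr (- (1 / \<alpha>))) \<partial>M_Wright_measure \<beta>) = ennreal (Gamma (1 - 1 / \<alpha>) / Gamma (1 - \<beta> / \<alpha>))"
proof -
  interpret \<mu>: prob_space "M_Wright_measure \<beta>" by (rule ggBm_prob_space_M_Wright[OF B])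
  show ?thesis
    using \<mu>.mittag_leffler_negative_moment[of "\<lambda>\<tau>. \<tau>" \<beta> "1 / \<alpha>"] AE_M_Wright_measure_pos[of \<beta>]
      ggBm_laplace_M_Wright[OF B] B \<alpha> by (simp add: ggBm_def)
qed

section \<open>Occupation measure\<close>

text \<open>Off a null set the paths are continuous, and there the process is the pointwise limit of
  its discretizations along $\lfloor nt \rfloor / n$, which are jointly measurable since
  they take the time parameter in a countable set. The version is set to 0 on the null
  set and constant in time for $t < 0$.\<close>
lemma jointly_measurable_version:
  fixes B :: "real \<Rightarrow> 'w \<Rightarrow> 'a::euclidean_space"
  assumes meas: "\<And>t. 0 \<le> t \<Longrightarrow> B t \<in> borel_measurable M"
    and cont: "AE \<omega> in M. continuous_on {0..} (\<lambda>t. B t \<omega>)"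
  obtains C :: "real \<Rightarrow> 'w \<Rightarrow> 'a" where
    "(\<lambda>p. C (snd p) (fst p)) \<in> borel_measurable (M \<Otimes>\<^sub>M lborel)"
    "AE \<omega> in M. \<forall>t\<ge>0. C t \<omega> = B t \<omega>"
proof -
  obtain N where N: "{\<omega> \<in> space M. \<not> continuous_on {0..} (\<lambda>t. B t \<omega>)} \<subseteq> N" "N \<in> null_sets M"
    using cont by (auto simp: eventually_ae_filter)
  have [measurable]: "N \<in> sets M" using N(2) by auto
  define C where "C t \<omega> = (if \<omega> \<in> N then 0 else B (max 0 t) \<omega>)" for t \<omega>
  define A where "A n i p = (if fst p \<in> N then 0 else B (real i / real (Suc n)) (fst p))" for n i :: nat and p :: "'w \<times> real"
  define k where "k n p = nat \<lfloor>real (Suc n) * max 0 (snd p)\<rfloor>" for n :: nat and p :: "'w \<times> real"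
  have B[measurable]: "B (real i / real (Suc n)) \<in> borel_measurable M" for i n
    by (rule meas) simp
  have A: "(\<lambda>p. A n (k n p) p) \<in> borel_measurable (M \<Otimes>\<^sub>M lborel)" for n
  proof (rule measurable_compose_countable'[where I = UNIV and f = "A n" and g = "k n"])
    show "A n i \<in> borel_measurable (M \<Otimes>\<^sub>M lborel)" for i
      unfolding A_def by measurable
    show "k n \<in> measurable (M \<Otimes>\<^sub>M lborel) (count_space UNIV)"
      unfolding k_def by measurable
  qed auto
  have "(\<lambda>p. C (snd p) (fst p)) \<in> borel_measurable (M \<Otimes>\<^sub>M lborel)"
  proof (rule borel_measurable_LIMSEQ_metric[OF A])
    fix p assume p: "p \<in> space (M \<Otimes>\<^sub>M (lborel :: real measure))"
    obtain \<omega> t where p_eq: "p = (\<omega>, t)" by (cases p)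
    show "(\<lambda>n. A n (k n p) p) \<longlonglongrightarrow> C (snd p) (fst p)"
    proof (cases "\<omega> \<in> N")
      case True
      then show ?thesis by (simp add: A_def C_def p_eq)
    next
      case False
      define s where "s = max 0 t"
      have s: "0 \<le> s" by (simp add: s_def)
      have "continuous_on {0..} (\<lambda>t. B t \<omega>)"
        using N(1) False p by (auto simp: p_eq space_pair_measure)
      moreover have "(\<lambda>n. real (k n p) / real (Suc n)) \<longlonglongrightarrow> s"
      proof (rule tendsto_sandwich)
        have k: "real (k n p) = of_int \<lfloor>real (Suc n) * s\<rfloor>" for n
          using s by (simp add: k_def p_eq s_def del: of_nat_Suc)
        have "(real (Suc n) * s - 1) / real (Suc n) \<le> real (k n p) / real (Suc n)" for n
          unfolding k by (intro divide_right_mono) linarith+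
        then have "s - 1 / real (Suc n) \<le> real (k n p) / real (Suc n)" for n
          by (simp add: diff_divide_distrib del: of_nat_Suc)
        then show "\<forall>\<^sub>F n in sequentially. s - 1 / real (Suc n) \<le> real (k n p) / real (Suc n)" by simp
        have "real (k n p) / real (Suc n) \<le> (real (Suc n) * s) / real (Suc n)" for n
          unfolding k by (intro divide_right_mono) linarith+
        then show "\<forall>\<^sub>F n in sequentially. real (k n p) / real (Suc n) \<le> s" by (simp del: of_nat_Suc)
        show "(\<lambda>n. s - 1 / real (Suc n)) \<longlonglongrightarrow> s"
          using tendsto_diff[OF tendsto_const[of s] LIMSEQ_inverse_real_of_nat]
          by (simp add: inverse_eq_divide)
      qed simp
      ultimately have "(\<lambda>n. B (real (k n p) / real (Suc n)) \<omega>) \<longlonglongrightarrow> B s \<omega>"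
        by (rule continuous_on_tendsto_compose) (use s in auto)
      then show ?thesis
        using False by (simp add: A_def C_def p_eq s_def del: of_nat_Suc)
    qed
  qed
  moreover have "AE \<omega> in M. \<forall>t\<ge>0. C t \<omega> = B t \<omega>"
    using AE_not_in[OF N(2)] by eventually_elim (simp add: C_def)
  ultimately show ?thesis by (rule that)
qed

lemma (in complete_measure) borel_measurable_AE_eq:
  assumes f[measurable]: "f \<in> borel_measurable M" and eq: "AE x in M. f x = g x"
  shows "g \<in> borel_measurable M"
proof (rule measurableI)
  fix A :: "'b set" assume [measurable]: "A \<in> sets borel"
  show "g -` A \<inter> space M \<in> sets M"
  proof (rule in_sets_AE)
    show "f -` A \<inter> space M \<in> sets M" by measurable
    show "AE x in M. x \<in> f -` A \<inter> space M \<longleftrightarrow> x \<in> g -` A \<inter> space M"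
      using eq by eventually_elim auto
  qed auto
qed auto

lemma perpetual_const_pos:
  assumes "0 < \<beta>" "\<beta> \<le> 1" "1 < \<alpha>" "2 < real d * \<alpha>"
  shows "0 < perpetual_const \<beta> \<alpha> d"
proof -
  have "0 < Gamma (real d / 2 - 1 / \<alpha>)" "0 < Gamma (1 - 1 / \<alpha>)" "0 < Gamma (1 - \<beta> / \<alpha>)"
    using assms by (auto intro!: Gamma_real_pos simp: field_simps)
  with assms show ?thesis by (simp add: perpetual_const_def)
qed

lemma ggBm_potential_kernel:
  fixes B :: "real \<Rightarrow> 'w \<Rightarrow> real ^ 'd" and y :: "real ^ 'd"
  assumes B: "ggBm M \<beta> \<alpha> B" and \<alpha>: "1 < \<alpha>" "2 < real CARD('d) * \<alpha>" and y: "y \<noteq> 0"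
  shows "(\<integral>\<^sup>+t. ennreal (indicator {0<..} t) * (\<integral>\<^sup>+\<tau>. ennreal (gauss (t powr \<alpha> * \<tau>) y) \<partial>M_Wright_measure \<beta>) \<partial>lborel)
    = ennreal (perpetual_const \<beta> \<alpha> CARD('d) / norm y powr (real CARD('d) - 2 / \<alpha>))"
proof -
  interpret \<mu>: prob_space "M_Wright_measure \<beta>" by (rule ggBm_prob_space_M_Wright[OF B])
  interpret P: pair_sigma_finite "M_Wright_measure \<beta>" "lborel :: real measure" ..
  define c where "c = 1 / \<alpha> * 2 powr (- (1 / \<alpha>)) * pi powr (- (real CARD('d) / 2)) * Gamma (real CARD('d) / 2 - 1 / \<alpha>)
        * (1 / norm y powr (real CARD('d) - 2 / \<alpha>))"
  have "0 < Gamma (real CARD('d) / 2 - 1 / \<alpha>)"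
    using \<alpha> by (auto intro!: Gamma_real_pos simp: field_simps)
  then have c: "0 \<le> c" using \<alpha> by (simp add: c_def)
  have "(\<integral>\<^sup>+t. ennreal (indicator {0<..} t) * (\<integral>\<^sup>+\<tau>. ennreal (gauss (t powr \<alpha> * \<tau>) y) \<partial>M_Wright_measure \<beta>) \<partial>lborel)
      = (\<integral>\<^sup>+t. \<integral>\<^sup>+\<tau>. ennreal (indicator {0<..} t * gauss (t powr \<alpha> * \<tau>) y) \<partial>M_Wright_measure \<beta> \<partial>lborel)"
    by (subst nn_integral_cmult[symmetric]) (auto simp: ennreal_mult')
  also have "\<dots> = (\<integral>\<^sup>+\<tau>. \<integral>\<^sup>+t. ennreal (indicator {0<..} t * gauss (t powr \<alpha> * \<tau>) y) \<partial>lborel \<partial>M_Wright_measure \<beta>)"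
    by (rule P.Fubini') measurable
  also have "\<dots> = (\<integral>\<^sup>+\<tau>. ennreal c * ennreal (\<tau> powr (- (1 / \<alpha>))) \<partial>M_Wright_measure \<beta>)"
    by (rule nn_integral_cong_AE, use AE_M_Wright_measure_pos in eventually_elim)
      (subst gauss_time_integral[OF y], use \<alpha> c in \<open>auto simp: c_def ennreal_mult'[symmetric]\<close>)
  also have "\<dots> = ennreal c * ennreal (Gamma (1 - 1 / \<alpha>) / Gamma (1 - \<beta> / \<alpha>))"
    by (simp add: nn_integral_cmult ggBm_M_Wright_moment[OF B \<alpha>(1)])
  finally show ?thesis
    unfolding ennreal_mult'[OF c, symmetric] by (simp add: c_def perpetual_const_def mult_ac)
qed

text \<open>Tonelli moves the expectation inside the time integral, the one-point law replaces it by an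
  integral over space, and a second use of Tonelli leaves the potential kernel. The joint
  measurability of \<open>C\<close> is what permits the first exchange.\<close>
lemma ggBm_occupation_formula:
  fixes B C :: "real \<Rightarrow> 'w \<Rightarrow> real ^ 'd" and g :: "real ^ 'd \<Rightarrow> ennreal"
  assumes B: "ggBm M \<beta> \<alpha> B" and \<alpha>: "1 < \<alpha>" "2 < real CARD('d) * \<alpha>"
    and C[measurable]: "(\<lambda>p. C (snd p) (fst p)) \<in> borel_measurable (M \<Otimes>\<^sub>M lborel)"
    and CB: "AE \<omega> in M. \<forall>t\<ge>0. C t \<omega> = B t \<omega>"
    and g[measurable]: "g \<in> borel_measurable borel"
  shows "(\<integral>\<^sup>+p. ennreal (indicator {0..} (snd p)) * g (C (snd p) (fst p)) \<partial>(M \<Otimes>\<^sub>M lborel))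
    = (\<integral>\<^sup>+y. g y * ennreal (perpetual_const \<beta> \<alpha> CARD('d) / norm y powr (real CARD('d) - 2 / \<alpha>)) \<partial>lborel)"
proof -
  interpret prob_space M using B by (simp add: ggBm_def)
  interpret \<mu>: prob_space "M_Wright_measure \<beta>" by (rule ggBm_prob_space_M_Wright[OF B])
  interpret P: pair_sigma_finite M "lborel :: real measure" ..
  let ?p = "\<lambda>t y :: real ^ 'd. \<integral>\<^sup>+\<tau>. ennreal (gauss (t powr \<alpha> * \<tau>) y) \<partial>M_Wright_measure \<beta>"
  have "(\<integral>\<^sup>+p. ennreal (indicator {0..} (snd p)) * g (C (snd p) (fst p)) \<partial>(M \<Otimes>\<^sub>M lborel))
     = (\<integral>\<^sup>+t. \<integral>\<^sup>+\<omega>. ennreal (indicator {0..} t) * g (C t \<omega>) \<partial>M \<partial>lborel)"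
    by (subst P.nn_integral_snd[symmetric]) simp_all
  also have "\<dots> = (\<integral>\<^sup>+t. \<integral>\<^sup>+y. g y * (ennreal (indicator {0<..} t) * ?p t y) \<partial>lborel \<partial>lborel)"
  proof (rule nn_integral_cong_AE, use AE_lborel_singleton[of 0] in eventually_elim)
    fix t :: real assume "t \<noteq> 0"
    then consider "t < 0" | "0 < t" by linarith
    then show "(\<integral>\<^sup>+\<omega>. ennreal (indicator {0..} t) * g (C t \<omega>) \<partial>M)
        = (\<integral>\<^sup>+y. g y * (ennreal (indicator {0<..} t) * ?p t y) \<partial>lborel)"
    proof cases
      case 2
      have "(\<integral>\<^sup>+\<omega>. g (C t \<omega>) \<partial>M) = (\<integral>\<^sup>+\<omega>. g (B t \<omega>) \<partial>M)"
        using CB 2 by (intro nn_integral_cong_AE) (auto elim!: eventually_mono)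
      then show ?thesis using 2 ggBm_one_time_law[OF B 2 g] by simp
    qed simp
  qed
  also have "\<dots> = (\<integral>\<^sup>+y. \<integral>\<^sup>+t. g y * (ennreal (indicator {0<..} t) * ?p t y) \<partial>lborel \<partial>lborel)"
    by (rule lborel_pair.Fubini') measurable
  also have "\<dots> = (\<integral>\<^sup>+y. g y * ennreal (perpetual_const \<beta> \<alpha> CARD('d) / norm y powr (real CARD('d) - 2 / \<alpha>)) \<partial>lborel)"
    by (rule nn_integral_cong_AE, use AE_lborel_singleton[of 0] in eventually_elim)
      (subst nn_integral_cmult, simp, simp add: ggBm_potential_kernel[OF B \<alpha>])
  finally show ?thesis .
qed

section \<open>Integrability of the Riesz potential\<close>

lemma nn_integral_gauss:
  assumes "0 < v"
  shows "(\<integral>\<^sup>+y. ennreal (gauss v (y :: 'a::euclidean_space)) \<partial>lborel) = 1"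
proof -
  obtain e :: 'a where e: "e \<in> Basis" by (meson SOME_Basis)
  have "2 * (\<integral>\<^sup>+y. ennreal (gauss v (y :: 'a)) \<partial>lborel) = 2 * 1"
    using nn_integral_cos_gauss[OF assms e, of 0] by (simp add: ennreal_mult' nn_integral_cmult)
  then show ?thesis
    unfolding ennreal_mult_cancel_left by simp
qed

text \<open>The kernel is a multiple of the time integral of \<open>gauss (t powr \<alpha>) y\<close>.
  Exchanging the integrals, the
  slice at time \<open>t\<close> is bounded by the sup norm of \<open>g\<close> for small \<open>t\<close> and by
  $\|g\|_1 (2\pi t^\alpha)^{-d/2}$ for large \<open>t\<close>, which is integrable since
  $\alpha d / 2 > 1$.\<close>
lemma integrable_riesz_potential:
  fixes g :: "'a::euclidean_space \<Rightarrow> real"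
  assumes g: "integrable lborel g" and bounded: "\<And>y. \<bar>g y\<bar> \<le> K" and \<alpha>: "0 < \<alpha>" "2 < real DIM('a) * \<alpha>"
  shows "integrable lborel (\<lambda>y. g y / norm y powr (real DIM('a) - 2 / \<alpha>))"
proof -
  have g_meas[measurable]: "g \<in> borel_measurable borel" using g by auto
  have K: "0 \<le> K" using bounded[of 0] by linarith
  define d where "d = real DIM('a)"
  define A where "A = 1 / \<alpha> * 2 powr (- (1 / \<alpha>)) * pi powr (- (d / 2)) * Gamma (d / 2 - 1 / \<alpha>)"
  have "0 < Gamma (d / 2 - 1 / \<alpha>)"
    using \<alpha> by (auto intro!: Gamma_real_pos simp: field_simps d_def)
  then have A: "0 < A" using \<alpha> by (simp add: A_def)
  define J where "J = (\<integral>\<^sup>+y. ennreal \<bar>g y\<bar> \<partial>lborel)"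
  have J: "J < \<infinity>" using g by (simp add: J_def integrable_iff_bounded)
  define q where "q = (2 * pi) powr (- (d / 2))"
  have slice: "(\<integral>\<^sup>+y. ennreal \<bar>g y\<bar> * ennreal (indicator {0<..} t * gauss (t powr \<alpha> * 1) y) \<partial>lborel)
      \<le> ennreal K * indicator {0..1} t + ennreal q * J * ennreal (indicator {1..} t * t powr (- \<alpha> * d / 2))" for t
  proof (cases "t \<le> 0")
    case False
    then have t: "0 < t" by simp
    show ?thesis
    proof (cases "t \<le> 1")
      case True
      have "(\<integral>\<^sup>+y. ennreal \<bar>g y\<bar> * ennreal (indicator {0<..} t * gauss (t powr \<alpha> * 1) y) \<partial>lborel)
        \<le> (\<integral>\<^sup>+y. ennreal K * ennreal (gauss (t powr \<alpha>) (y :: 'a)) \<partial>lborel)"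
        by (intro nn_integral_mono mult_mono) (use t bounded in \<open>auto intro: ennreal_leI\<close>)
      also have "\<dots> = ennreal K"
        by (subst nn_integral_cmult) (use t in \<open>simp_all add: nn_integral_gauss\<close>)
      also have "\<dots> = ennreal K * indicator {0..1} t"
        using True t by simp
      also have "\<dots> \<le> \<dots> + ennreal q * J * ennreal (indicator {1..} t * t powr (- \<alpha> * d / 2))"
        by simp
      finally show ?thesis .
    next
      case False
      have le: "gauss (t powr \<alpha>) y \<le> q * t powr (- \<alpha> * d / 2)" for y :: 'a
      proof -
        have "gauss (t powr \<alpha>) y \<le> (2 * pi * t powr \<alpha>) powr (- (d / 2)) * 1"
          unfolding gauss_def d_def by (intro mult_left_mono) auto
        also have "\<dots> = q * t powr (- \<alpha> * d / 2)"
          by (simp add: q_def powr_mult powr_powr)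
        finally show ?thesis .
      qed
      have "(\<integral>\<^sup>+y. ennreal \<bar>g y\<bar> * ennreal (indicator {0<..} t * gauss (t powr \<alpha> * 1) y) \<partial>lborel)
        \<le> (\<integral>\<^sup>+y. ennreal \<bar>g y\<bar> * ennreal (q * t powr (- \<alpha> * d / 2)) \<partial>lborel)"
        by (intro nn_integral_mono mult_left_mono) (use t le in \<open>auto intro: ennreal_leI\<close>)
      also have "\<dots> = J * ennreal (q * t powr (- \<alpha> * d / 2))"
        unfolding J_def by (rule nn_integral_multc) simp
      finally show ?thesis using False by (simp add: q_def ennreal_mult' mult_ac)
    qed
  qed simp
  have pow: "(\<integral>\<^sup>+t. ennreal (indicator {1..} t * t powr (- \<alpha> * d / 2)) \<partial>lborel) < \<infinity>"
  proof -
    have "- \<alpha> * d / 2 < - 1" using \<alpha> by (simp add: d_def mult.commute)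
    then have "((\<lambda>t. t powr (- \<alpha> * d / 2)) has_integral - (1 powr (- \<alpha> * d / 2 + 1)) / (- \<alpha> * d / 2 + 1)) {1..}"
      by (intro has_integral_powr_to_inf) auto
    then show ?thesis by (subst nn_integral_has_integral_lebesgue) auto
  qed
  have "(\<integral>\<^sup>+y. ennreal \<bar>g y\<bar> * ennreal (A / norm y powr (d - 2 / \<alpha>)) \<partial>lborel)
    = (\<integral>\<^sup>+y. \<integral>\<^sup>+t. ennreal \<bar>g y\<bar> * ennreal (indicator {0<..} t * gauss (t powr \<alpha> * 1) y) \<partial>lborel \<partial>lborel)"
    by (rule nn_integral_cong_AE, use AE_lborel_singleton[of 0] in eventually_elim)
      (subst nn_integral_cmult, simp, subst gauss_time_integral, use \<alpha> in \<open>auto simp: A_def d_def\<close>)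
  also have "\<dots> = (\<integral>\<^sup>+t. \<integral>\<^sup>+y. ennreal \<bar>g y\<bar> * ennreal (indicator {0<..} t * gauss (t powr \<alpha> * 1) y) \<partial>lborel \<partial>lborel)"
    by (rule lborel_pair.Fubini'[symmetric]) measurable
  also have "\<dots> \<le> (\<integral>\<^sup>+t. ennreal K * indicator {0..1} t + ennreal q * J * ennreal (indicator {1..} t * t powr (- \<alpha> * d / 2)) \<partial>lborel)"
    by (intro nn_integral_mono slice)
  also have "\<dots> = ennreal K + ennreal q * J * (\<integral>\<^sup>+t. ennreal (indicator {1..} t * t powr (- \<alpha> * d / 2)) \<partial>lborel)"
    by (subst nn_integral_add) (auto simp: nn_integral_cmult nn_integral_cmult_indicator)
  also have "\<dots> < \<infinity>"
    using J pow by (simp add: ennreal_mult_less_top)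
  finally have fin: "(\<integral>\<^sup>+y. ennreal \<bar>g y\<bar> * ennreal (A / norm y powr (d - 2 / \<alpha>)) \<partial>lborel) < \<infinity>" .
  have "integrable lborel (\<lambda>y. g y * (A / norm y powr (d - 2 / \<alpha>)))"
  proof (rule integrableI_bounded)
    show "(\<integral>\<^sup>+y. ennreal (norm (g y * (A / norm y powr (d - 2 / \<alpha>)))) \<partial>lborel) < \<infinity>"
      using fin A by (simp add: abs_mult ennreal_mult'[symmetric])
  qed simp
  then have "integrable lborel (\<lambda>y. 1 / A * (g y * (A / norm y powr (d - 2 / \<alpha>))))"
    by (rule integrable_mult_right)
  then show ?thesis using A by (simp add: d_def)
qed

section \<open>The perpetual integral functional\<close>

theorem theorem3p2:
  fixes M :: "'w measure"
    and B :: "real \<Rightarrow> 'w \<Rightarrow> real ^ 'd"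
    and f :: "real ^ 'd \<Rightarrow> real"
    and x :: "real ^ 'd"
    and \<alpha> \<beta> :: real
  assumes "prob_space M" and "complete_measure M"
    and "0 < \<beta>" and "\<beta> \<le> 1" and "1 < \<alpha>" and "\<alpha> \<le> 2"
    and "real CARD('d) * \<alpha> > 2"
    and "ggBm M \<beta> \<alpha> B"
    and "f \<in> CL"
  shows "(AE \<omega> in M. set_integrable lborel {0..} (\<lambda>t. f (x + B t \<omega>))) \<and>
         integrable M (\<lambda>\<omega>. LINT t:{0..}|lborel. f (x + B t \<omega>)) \<and>
         integrable lborel (\<lambda>y. f (x + y) / norm y powr (real CARD('d) - 2 / \<alpha>)) \<and>
         (LINT \<omega>|M. (LINT t:{0..}|lborel. f (x + B t \<omega>))) =
           perpetual_const \<beta> \<alpha> CARD('d) *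
           (LINT y|lborel. f (x + y) / norm y powr (real CARD('d) - 2 / \<alpha>))"
proof -
  interpret prob_space M by fact
  interpret complete_measure M by fact
  interpret P: pair_sigma_finite M "lborel :: real measure" ..
  define D where "D = perpetual_const \<beta> \<alpha> CARD('d)"
  define g where "g y = f (x + y)" for y
  define r where "r y = D / norm y powr (real CARD('d) - 2 / \<alpha>)" for y :: "real ^ 'd"
  have D: "0 < D"
    unfolding D_def by (rule perpetual_const_pos) (use assms in auto)
  have r: "0 \<le> r y" for y using D by (simp add: r_def)
  have r_meas[measurable]: "r \<in> borel_measurable borel" unfolding r_def[abs_def] by measurable
  have f: "continuous_on UNIV f" "bounded (range f)" "integrable lborel f"
    using assms by (auto simp: CL_def)
  have g_meas[measurable]: "g \<in> borel_measurable borel"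
    unfolding g_def[abs_def] using borel_measurable_continuous_onI[OF f(1)] by measurable
  have g_int: "integrable lborel g"
  proof -
    have "integrable (distr lborel borel ((+) x)) f"
      using f(3) by (simp add: lborel_distr_plus)
    then show ?thesis
      unfolding g_def[abs_def] by (subst (asm) integrable_distr_eq) (use f(3) in auto)
  qed
  obtain K where K: "\<And>y. \<bar>g y\<bar> \<le> K"
    using f(2) by (auto simp: bounded_iff g_def)
  have riesz: "integrable lborel (\<lambda>y. g y / norm y powr (real CARD('d) - 2 / \<alpha>))"
    using integrable_riesz_potential[OF g_int K, of \<alpha>] assms by simp
  then have gr: "integrable lborel (\<lambda>y. g y * r y)"
    using integrable_mult_right[OF riesz, of D] by (simp add: r_def mult_ac)
  obtain C where C[measurable]: "(\<lambda>p. C (snd p) (fst p)) \<in> borel_measurable (M \<Otimes>\<^sub>M lborel)"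
    and CB: "AE \<omega> in M. \<forall>t\<ge>0. C t \<omega> = B t \<omega>"
  proof (rule jointly_measurable_version[of B M])
    show "B t \<in> borel_measurable M" if "0 \<le> t" for t
      using assms(8) that by (simp add: ggBm_def)
    show "AE \<omega> in M. continuous_on {0..} (\<lambda>t. B t \<omega>)"
      using assms(8) by (simp add: ggBm_def)
  qed
  \<comment> \<open>The integrand is built from the version \<open>C\<close>, because \<open>B\<close> itself is only known to be measurable at fixed times.\<close>
  define h where "h p = indicator {0..} (snd p) * g (C (snd p) (fst p))" for p
  have h_meas[measurable]: "h \<in> borel_measurable (M \<Otimes>\<^sub>M lborel)"
    unfolding h_def[abs_def] by measurable
  have occ: "(\<integral>\<^sup>+p. ennreal (indicator {0..} (snd p) * k (C (snd p) (fst p))) \<partial>(M \<Otimes>\<^sub>M lborel))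
      = (\<integral>\<^sup>+y. ennreal (k y * r y) \<partial>lborel)"
    if [measurable]: "k \<in> borel_measurable borel" for k
    using ggBm_occupation_formula[OF assms(8,5,7) C CB, of "\<lambda>y. ennreal (k y)"] r
    by (simp add: D_def[symmetric] r_def[symmetric] ennreal_mult' ennreal_mult'')
  have h_int: "integrable (M \<Otimes>\<^sub>M lborel) h"
  proof (rule integrableI_bounded)
    show "(\<integral>\<^sup>+p. ennreal (norm (h p)) \<partial>(M \<Otimes>\<^sub>M lborel)) < \<infinity>"
      using occ[of "\<lambda>y. \<bar>g y\<bar>"] gr r by (simp add: h_def abs_mult integrable_iff_bounded)
  qed simp
  have h_val: "(LINT p|(M \<Otimes>\<^sub>M lborel). h p) = (LINT y|lborel. g y * r y)"
    unfolding real_lebesgue_integral_def[OF h_int] real_lebesgue_integral_def[OF gr]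
    using occ[of g] occ[of "\<lambda>y. - g y"] by (simp add: h_def)
  have path: "AE \<omega> in M. (\<lambda>t. indicator {0..} t *\<^sub>R f (x + B t \<omega>)) = (\<lambda>t. h (\<omega>, t))"
    using CB by eventually_elim (auto simp: h_def g_def indicator_def)
  have "AE \<omega> in M. set_integrable lborel {0..} (\<lambda>t. f (x + B t \<omega>))"
    using path P.AE_integrable_fst'[OF h_int]
    by eventually_elim (simp add: set_integrable_def)
  moreover have eq: "AE \<omega> in M. (LINT t|lborel. h (\<omega>, t)) = (LINT t:{0..}|lborel. f (x + B t \<omega>))"
    using path by eventually_elim (simp add: set_lebesgue_integral_def)
  \<comment> \<open>Completeness enters here: the functional of \<open>B\<close> may be arbitrary on a null set.\<close>
  moreover have meas: "(\<lambda>\<omega>. LINT t:{0..}|lborel. f (x + B t \<omega>)) \<in> borel_measurable M"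
    by (rule borel_measurable_AE_eq[OF _ eq]) measurable
  moreover have "integrable M (\<lambda>\<omega>. LINT t:{0..}|lborel. f (x + B t \<omega>))"
    using integrable_cong_AE_imp[OF P.integrable_fst'[OF h_int] meas] eq by (auto elim: eventually_mono)
  moreover have "(LINT \<omega>|M. (LINT t:{0..}|lborel. f (x + B t \<omega>))) = (LINT y|lborel. g y * r y)"
  proof -
    have "(LINT \<omega>|M. (LINT t:{0..}|lborel. f (x + B t \<omega>))) = (LINT \<omega>|M. LINT t|lborel. h (\<omega>, t))"
      by (rule integral_cong_AE[OF meas]) (use eq in \<open>auto elim: eventually_mono\<close>)
    also have "\<dots> = (LINT y|lborel. g y * r y)"
      using P.integral_fst'[OF h_int] h_val by simp
    finally show ?thesis .
  qed
  moreover have "(LINT y|lborel. g y * r y) = D * (LINT y|lborel. g y / norm y powr (real CARD('d) - 2 / \<alpha>))"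
    by (subst integral_mult_right_zero[symmetric]) (simp add: r_def mult_ac)
  ultimately show ?thesis
    using riesz by (simp add: g_def D_def)
qed

end
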